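(* Let $\hbar>0$ and let $P,q,r$ be real numbers with $q,r\neq 0$; put $Q=q^2$, $R=r^2$ and assume $P+Q\neq0$, $P+R\neq0$. Consider the two quadratic Lagrangians $$\mathcal L_a(x,y)=\frac1r\Big((P+R)\,xy+\tfrac12(P-R)(x^2+y^2)\Big),\qquad \mathcal L_b(x,y)=\frac1q\Big((P+Q)\,xy+\tfrac12(P-Q)(x^2+y^2)\Big),$$ and, for a lattice path $\Gamma$ in $\mathbb Z^2$ (forward and backward steps and self-intersections allowed), the propagator $K_\Gamma$ along $\Gamma$ built from these Lagrangians as defined in the context. Then $K_\Gamma$ depends only on the end points of $\Gamma$: if $\Gamma_1$ and $\Gamma_2$ are two lattice paths in $\mathbb Z^2$ with the same initial point and the same final point, then $K_{\Gamma_1}=K_{\Gamma_2}$.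
   Context: Lattice paths. A lattice path $\Gamma$ in $\mathbb Z^2$ is a finite sequence of points $\mathbf n_0,\mathbf n_1,\dots,\mathbf n_\ell$ ($\ell\ge1$) of $\mathbb Z^2$ in which each step $\mathbf n_{s}-\mathbf n_{s-1}$ is one of $\pm\mathbf e_b$ (steps in the first, "hat", time direction) or $\pm\mathbf e_a$ (steps in the second, "bar", time direction), where $\mathbf e_b=(1,0)$, $\mathbf e_a=(0,1)$. One-step kernels. For real $x$ (variable before the step) and $y$ (variable after the step): - step $+\mathbf e_b$: $K_{+b}(x,y)=\left(\frac{i(P+Q)}{2\pi\hbar q}\right)^{1/2}\exp\left[\frac{i}{\hbar}\mathcal L_b(x,y)\right]$; - step $+\mathbf e_a$: $K_{+a}(x,y)=\left(\frac{i(P+R)}{2\pi\hbar r}\right)^{1/2}\exp\left[\frac{i}{\hbar}\mathcal L_a(x,y)\right]$; - steps $-\mathbf e_b$, $-\mathbf e_a$ (backward steps): $K_{-b}(x,y)=\overline{K_{+b}(y,x)}$, $K_{-a}(x,y)=\overline{K_{+a}(y,x)}$, i.e. the Lagrangian enters with a minus sign and the normalisation factor is complex conjugated. Square roots are taken with the principal branch. Propagator along $\Gamma$. A separate real variable $x_s$ is attached to each $s=0,\dots,\ell$ (so a lattice point visited several times carries several variables), and $$K_\Gamma(x_0,x_\ell)=\int_{\mathbb R}dx_1\cdots\int_{\mathbb R}dx_{\ell-1}\ \prod_{s=1}^{\ell}K_{\mathrm{step}_s}(x_{s-1},x_s),$$ where $\mathrm{step}_s$ is the type of the $s$-th step. The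 integrals are oscillatory (Fresnel) Gaussian integrals, with $\int_{\mathbb R}e^{ikx}dx=2\pi\delta(k)$. Equivalently, each one-step kernel $K$ defines a unitary operator on $L^2(\mathbb R)$ by $\psi\mapsto\int K(x,\cdot)\psi(x)\,dx$, and $K_\Gamma$ is the (distributional) kernel of the composition of these operators in the order of the steps; equality of propagators means equality of these operators. *)

theory Defs
  imports "HOL-Analysis.Analysis"
begin

definition square_integrable :: "(real \<Rightarrow> complex) \<Rightarrow> bool" where
  "square_integrable f \<longleftrightarrow>
     f \<in> borel_measurable lborel \<and> integrable lborel (\<lambda>x. (cmod (f x))\<^sup>2)"

definition L2_rel :: "(real \<Rightarrow> complex) \<Rightarrow> (real \<Rightarrow> complex) \<Rightarrow> bool" where
  "L2_rel f g \<longleftrightarrow>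
     square_integrable f \<and> square_integrable g \<and> (AE x in lborel. f x = g x)"

text \<open>The elements of \<open>L\<^sup>2(\<real>)\<close>: square integrable functions modulo equality almost everywhere.\<close>

quotient_type L2 = "real \<Rightarrow> complex" / partial: L2_rel
proof (rule part_equivpI)
  show "\<exists>f. L2_rel f f"
    by (rule exI[of _ "\<lambda>_. 0"]) (simp add: L2_rel_def square_integrable_def)
  show "symp L2_rel"
    by (rule sympI) (auto simp: L2_rel_def eq_commute)
  show "transp L2_rel"
    by (rule transpI) (auto simp: L2_rel_def elim: AE_mp)
qed

text \<open>
  The operator \<open>\<psi> \<mapsto> \<integral> K(x, \<cdot>) \<psi>(x) dx\<close> on \<open>L\<^sup>2(\<real>)\<close>.  For a Fresnel kernel the integral need not
  converge absolutely, so, as for the Fourier transform, it is the limit in \<open>L\<^sup>2\<close> of the truncated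
  integrals over \<open>[-N, N]\<close>.  The norm is written with the extended nonnegative integral because
  the Bochner integral of a function that is not integrable is \<open>0\<close>.  The choice of representatives
  made by \<open>rep_L2\<close> is immaterial for (jointly) measurable kernels.
\<close>

definition kernel_op :: "(real \<Rightarrow> real \<Rightarrow> complex) \<Rightarrow> L2 \<Rightarrow> L2" where
  "kernel_op K \<psi> = (THE \<phi>.
     ((\<lambda>N::real. \<integral>\<^sup>+ y. ennreal ((cmod (rep_L2 \<phi> y -
         (LINT x:{-N..N}|lborel. K x y * rep_L2 \<psi> x)))\<^sup>2) \<partial>lborel) \<longlongrightarrow> 0) at_top)"

text \<open>
  The two Lagrangians have the same shape: \<open>\<L>\<^sub>a\<close> is \<open>lagrangian P r\<close> and \<open>\<L>\<^sub>b\<close> is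
  \<open>lagrangian P q\<close>, with \<open>R = r\<^sup>2\<close> and \<open>Q = q\<^sup>2\<close>.
\<close>

definition lagrangian :: "real \<Rightarrow> real \<Rightarrow> real \<Rightarrow> real \<Rightarrow> real" where
  "lagrangian P s x y =
     1 / s * ((P + s\<^sup>2) * x * y + 1 / 2 * (P - s\<^sup>2) * (x\<^sup>2 + y\<^sup>2))"

definition forward_kernel :: "real \<Rightarrow> real \<Rightarrow> real \<Rightarrow> real \<Rightarrow> real \<Rightarrow> complex" where
  "forward_kernel hbar P s x y =
     csqrt (\<i> * of_real (P + s\<^sup>2) / of_real (2 * pi * hbar * s)) *
     exp (\<i> / of_real hbar * of_real (lagrangian P s x y))"

definition backward_kernel :: "real \<Rightarrow> real \<Rightarrow> real \<Rightarrow> real \<Rightarrow> real \<Rightarrow> complex" where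
  "backward_kernel hbar P s x y = cnj (forward_kernel hbar P s y x)"

definition lattice_path :: "(int \<times> int) list \<Rightarrow> bool" where
  "lattice_path \<Gamma> \<longleftrightarrow> length \<Gamma> \<ge> 2 \<and>
     (\<forall>s < length \<Gamma> - 1. \<Gamma> ! (s + 1) - \<Gamma> ! s \<in> {(1, 0), (-1, 0), (0, 1), (0, -1)})"

text \<open>The last branch is never reached along a lattice path.\<close>

definition step_kernel ::
    "real \<Rightarrow> real \<Rightarrow> real \<Rightarrow> real \<Rightarrow> int \<times> int \<Rightarrow> real \<Rightarrow> real \<Rightarrow> complex" where
  "step_kernel hbar P q r d =
     (if d = (1, 0) then forward_kernel hbar P q
      else if d = (0, 1) then forward_kernel hbar P r
      else if d = (-1, 0) then backward_kernel hbar P q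
      else if d = (0, -1) then backward_kernel hbar P r
      else (\<lambda>x y. 0))"

text \<open>
  The propagator along a path, as the operator on \<open>L\<^sup>2(\<real>)\<close> whose distributional kernel is
  \<open>K\<^sub>\<Gamma>\<close>: the operator of the first step is applied first.
\<close>

fun propagator ::
    "real \<Rightarrow> real \<Rightarrow> real \<Rightarrow> real \<Rightarrow> (int \<times> int) list \<Rightarrow> L2 \<Rightarrow> L2" where
  "propagator hbar P q r (m # n # ns) =
     propagator hbar P q r (n # ns) \<circ> kernel_op (step_kernel hbar P q r (n - m))"
| "propagator hbar P q r _ = id"

end

theory Submission
  imports Defs "HOL-Probability.Levy" "HOL-Complex_Analysis.Conformal_Mappings"
begin

text \<open>
  Every one-step kernel is a chirp \<open>c exp (\<i> (a x\<^sup>2 + \<alpha> x y + a y\<^sup>2))\<close> with real \<open>a\<close> and \<open>\<alpha> \<noteq> 0\<close>.  By a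
  Plancherel type bound its truncated integrals converge in \<open>L\<^sup>2\<close>, and, the kernel being symmetric, the limit
  operator can be moved to the other side of the bilinear pairing with a Gaussian \<open>exp (- z x\<^sup>2 + w x)\<close>,
  \<open>Re z > 0\<close>.  It maps Gaussians to explicit multiples of Gaussians, and an element of \<open>L\<^sup>2\<close> is determined by
  its pairings with Gaussians (uniqueness of the Fourier transform).  So identities between products of
  one-step operators reduce to algebra with the parameters; the principal square roots cause no sign ambiguity
  because a product of two square roots of numbers in the right half plane has positive real part.  One finds
  that the backward operators invert the forward ones, and that the operators of the two directions commute
  because \<open>\<alpha>\<^sup>2 - 4 a\<^sup>2 = 4 P / hbar\<^sup>2\<close> for both.  Hence a path acts by the powers of two commuting bijections
  given by its displacement.
\<close>

section \<open>Complex Gaussian integrals\<close>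

text \<open>The linear coefficient \<open>w\<close> is complex: imaginary \<open>w\<close> gives
  Fourier modes under a Gaussian weight, and the family is closed, up to constants, under
  integration against a chirp.\<close>

definition gauss :: "complex \<Rightarrow> complex \<Rightarrow> real \<Rightarrow> complex" where
  "gauss z w x = exp (- z * (of_real x)\<^sup>2 + w * of_real x)"

lemma cmod_gauss: "cmod (gauss z w x) = exp (- Re z * x\<^sup>2 + Re w * x)"
  by (simp add: gauss_def flip: of_real_power)

lemma measurable_gauss [measurable]: "gauss z w \<in> borel_measurable borel"
  unfolding gauss_def by measurable

text \<open>Completing the square shows the integrand to be a multiple of the normal density with
  mean \<open>t / (2 * s)\<close> and variance \<open>1 / (2 * s)\<close>.\<close>

lemma real_gaussian_integral:
  fixes s t :: real
  assumes "s > 0"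
  shows "has_bochner_integral lborel (\<lambda>x. exp (- s * x\<^sup>2 + t * x)) (sqrt (pi / s) * exp (t\<^sup>2 / (4 * s)))"
proof -
  define \<sigma> where "\<sigma> = 1 / sqrt (2 * s)"
  have \<sigma>: "\<sigma> > 0" "\<sigma>\<^sup>2 = 1 / (2 * s)" using assms by (simp_all add: \<sigma>_def power_divide)
  have "has_bochner_integral lborel (normal_density (t / (2 * s)) \<sigma>) 1"
    using \<sigma> by (simp add: has_bochner_integral_iff)
  from has_bochner_integral_mult_right[of "sqrt (pi / s) * exp (t\<^sup>2 / (4 * s))", OF this]
  have "has_bochner_integral lborel
    (\<lambda>x. sqrt (pi / s) * exp (t\<^sup>2 / (4 * s)) * normal_density (t / (2 * s)) \<sigma> x)
    (sqrt (pi / s) * exp (t\<^sup>2 / (4 * s)))" by simp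
  moreover have "sqrt (pi / s) * exp (t\<^sup>2 / (4 * s)) * normal_density (t / (2 * s)) \<sigma> x
      = exp (- s * x\<^sup>2 + t * x)" for x
  proof -
    have "t\<^sup>2 / (4 * s) + - (x - t / (2 * s))\<^sup>2 / (2 * \<sigma>\<^sup>2) = - s * x\<^sup>2 + t * x"
      using assms unfolding \<sigma>(2) by (simp add: field_simps power2_eq_square)
    then have E: "exp (t\<^sup>2 / (4 * s)) * exp (- (x - t / (2 * s))\<^sup>2 / (2 * \<sigma>\<^sup>2)) = exp (- s * x\<^sup>2 + t * x)"
      unfolding exp_add[symmetric] by simp
    have K: "sqrt (pi / s) * (1 / sqrt (2 * pi * \<sigma>\<^sup>2)) = 1"
      using assms unfolding \<sigma>(2) by simp
    have "sqrt (pi / s) * (1 / sqrt (2 * pi * \<sigma>\<^sup>2)) *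
        (exp (t\<^sup>2 / (4 * s)) * exp (- (x - t / (2 * s))\<^sup>2 / (2 * \<sigma>\<^sup>2))) = exp (- s * x\<^sup>2 + t * x)"
      unfolding E K by simp
    then show ?thesis unfolding normal_density_def by (simp only: mult_ac)
  qed
  ultimately show ?thesis by simp
qed

lemma integrable_gauss:
  assumes "Re z > 0"
  shows "integrable lborel (gauss z w)"
proof (rule Bochner_Integration.integrable_bound)
  show "integrable lborel (\<lambda>x. exp (- Re z * x\<^sup>2 + Re w * x))"
    using real_gaussian_integral[OF assms] by (rule integrable.intros)
qed (auto simp: cmod_gauss)

text \<open>Integrals over \<open>[-n, n]\<close> are holomorphic by differentiation under the
  integral sign. They converge uniformly on closed disks inside the half plane, because there a
  single integrable function dominates all the integrands.\<close>

lemma holomorphic_gaussian_integral: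
  fixes z0 z1 w0 w1 :: complex
  defines "S \<equiv> {\<zeta>. Re (z0 + \<zeta> * z1) > 0}"
  shows "(\<lambda>\<zeta>. LINT x|lborel. gauss (z0 + \<zeta> * z1) (w0 + \<zeta> * w1) x) holomorphic_on S"
proof (rule holomorphic_uniform_sequence)
  let ?p = "\<lambda>\<zeta> x. gauss (z0 + \<zeta> * z1) (w0 + \<zeta> * w1) x"
  let ?f = "\<lambda>(n::nat) \<zeta>. integral (cbox (- real n) (real n)) (?p \<zeta>)"
  show S: "open S" unfolding S_def by (intro open_Collect_less continuous_intros)
  have S_eq: "S = {\<zeta>. cnj z1 \<bullet> \<zeta> > - Re z0}"
    by (auto simp: S_def inner_complex_def algebra_simps)
  have "convex S" unfolding S_eq by (rule convex_halfspace_gt)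
  show "?f n holomorphic_on S" for n
  proof (rule leibniz_rule_holomorphic)
    fix \<zeta> t assume "\<zeta> \<in> S" "t \<in> cbox (- real n) (real n)"
    show "((\<lambda>\<zeta>. ?p \<zeta> t) has_field_derivative ?p \<zeta> t * (- z1 * (of_real t)\<^sup>2 + w1 * of_real t)) (at \<zeta> within S)"
      unfolding gauss_def by (auto intro!: derivative_eq_intros)
  next
    fix \<zeta> show "?p \<zeta> integrable_on cbox (- real n) (real n)"
      unfolding gauss_def by (intro integrable_continuous continuous_intros)
  next
    show "continuous_on (S \<times> cbox (- real n) (real n)) (\<lambda>(\<zeta>, t). ?p \<zeta> t * (- z1 * (of_real t)\<^sup>2 + w1 * of_real t))"
      unfolding gauss_def split_def by (intro continuous_intros)
  qed fact
  fix \<zeta>0 assume "\<zeta>0 \<in> S"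
  with S obtain d where d: "d > 0" "cball \<zeta>0 d \<subseteq> S" using open_contains_cball by blast
  have "continuous_on (cball \<zeta>0 d) (\<lambda>\<zeta>. Re (z0 + \<zeta> * z1))" by (intro continuous_intros)
  from continuous_attains_inf[OF compact_cball _ this] d(1)
  obtain \<zeta>m where \<zeta>m: "\<zeta>m \<in> cball \<zeta>0 d"
     "\<And>\<zeta>. \<zeta> \<in> cball \<zeta>0 d \<Longrightarrow> Re (z0 + \<zeta>m * z1) \<le> Re (z0 + \<zeta> * z1)" by fastforce
  \<comment> \<open>The least real part of the quadratic coefficient on the disk: a common rate of
    Gaussian decay.\<close>
  define \<delta> where "\<delta> = Re (z0 + \<zeta>m * z1)"
  have \<delta>: "\<delta> > 0" using \<zeta>m(1) d(2) unfolding \<delta>_def S_def by blast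
  have "compact ((\<lambda>\<zeta>. Re (w0 + \<zeta> * w1)) ` cball \<zeta>0 d)"
    by (intro compact_continuous_image continuous_intros compact_cball)
  from compact_imp_bounded[OF this] obtain M
    where M: "\<And>\<zeta>. \<zeta> \<in> cball \<zeta>0 d \<Longrightarrow> \<bar>Re (w0 + \<zeta> * w1)\<bar> \<le> M"
    unfolding bounded_iff by (metis imageI real_norm_def)
  \<comment> \<open>The sum of the two exponentials dominates
    \<open>exp (- \<delta> * x\<^sup>2 + M * \<bar>x\<bar>)\<close> and is integrable by the real
    Gaussian formula.\<close>
  define B where "B x = exp (- \<delta> * x\<^sup>2 + M * x) + exp (- \<delta> * x\<^sup>2 + (- M) * x)" for x
  have B: "integrable lborel B" unfolding B_def
    using real_gaussian_integral[OF \<delta>] by (intro Bochner_Integration.integrable_add integrable.intros)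
  have pB: "cmod (?p \<zeta> x) \<le> B x" if "\<zeta> \<in> cball \<zeta>0 d" for \<zeta> x
  proof -
    have 1: "- Re (z0 + \<zeta> * z1) * x\<^sup>2 \<le> - \<delta> * x\<^sup>2"
      using \<zeta>m(2)[OF that] unfolding \<delta>_def by (intro mult_right_mono) auto
    have "Re (w0 + \<zeta> * w1) * x \<le> M * \<bar>x\<bar>"
      using M[OF that] abs_ge_self[of "Re (w0 + \<zeta> * w1) * x"]
      by (metis abs_ge_zero abs_mult mult_right_mono order_trans)
    with 1 have "cmod (?p \<zeta> x) \<le> exp (- \<delta> * x\<^sup>2 + M * \<bar>x\<bar>)" unfolding cmod_gauss by simp
    also have "\<dots> \<le> B x" unfolding B_def by (cases "x \<ge> 0") auto
    finally show ?thesis .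
  qed
  \<comment> \<open>The mass of \<open>B\<close> outside \<open>[-n, n]\<close> bounds the
    truncation error uniformly on the disk.\<close>
  define \<beta> where "\<beta> n = (LINT x|lborel. indicator (- {- real n..real n}) x *\<^sub>R B x)" for n
  have "\<beta> \<longlonglongrightarrow> (LINT x::real|lborel. 0 :: real)" unfolding \<beta>_def
  proof (rule Bochner_Integration.integral_dominated_convergence[where w = B])
    show "AE x in lborel. (\<lambda>n. indicator (- {- real n..real n}) x *\<^sub>R B x) \<longlonglongrightarrow> 0"
    proof (rule AE_I2)
      fix x
      obtain N where "\<bar>x\<bar> \<le> real N" using real_arch_simple by blast
      then have "\<forall>\<^sub>F n in sequentially. indicator (- {- real n..real n}) x *\<^sub>R B x = 0"
        by (intro eventually_sequentiallyI[of N]) (auto simp: indicator_def)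
      then show "(\<lambda>n. indicator (- {- real n..real n}) x *\<^sub>R B x) \<longlonglongrightarrow> 0" by (rule tendsto_eventually)
    qed
    show "integrable lborel B" by fact
    show "AE x in lborel. norm (indicator (- {- real n..real n}) x *\<^sub>R B x) \<le> B x" for n
      by (auto simp: B_def indicator_def)
  qed (use B in auto)
  then have \<beta>0: "\<beta> \<longlonglongrightarrow> 0" by simp
  have bd: "cmod (?f n \<zeta> - (LINT x|lborel. ?p \<zeta> x)) \<le> \<beta> n" if "\<zeta> \<in> cball \<zeta>0 d" for n \<zeta>
  proof -
    have "\<zeta> \<in> S" using that d by blast
    then have i: "integrable lborel (?p \<zeta>)" by (intro integrable_gauss) (auto simp: S_def)
    then have si: "set_integrable lborel {- real n..real n} (?p \<zeta>)"
      by (simp add: set_integrable_def integrable_mult_indicator)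
    have si': "integrable lborel (\<lambda>x. indicator (- {- real n..real n}) x *\<^sub>R ?p \<zeta> x)"
      using i by (intro integrable_mult_indicator) auto
    have "(LINT x|lborel. ?p \<zeta> x) - ?f n \<zeta> = (LINT x|lborel. ?p \<zeta> x) - (LINT x:{- real n..real n}|lborel. ?p \<zeta> x)"
      using set_borel_integral_eq_integral(2)[OF si] by simp
    also have "\<dots> = (LINT x|lborel. indicator (- {- real n..real n}) x *\<^sub>R ?p \<zeta> x)"
    proof -
      have "(LINT x|lborel. ?p \<zeta> x) - (LINT x:{- real n..real n}|lborel. ?p \<zeta> x)
        = (LINT x|lborel. ?p \<zeta> x - indicator {- real n..real n} x *\<^sub>R ?p \<zeta> x)"
        unfolding set_lebesgue_integral_def using i si unfolding set_integrable_def
        by (rule Bochner_Integration.integral_diff[symmetric])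
      also have "\<dots> = (LINT x|lborel. indicator (- {- real n..real n}) x *\<^sub>R ?p \<zeta> x)"
        by (rule Bochner_Integration.integral_cong) (simp_all add: indicator_def)
      finally show ?thesis .
    qed
    finally have "cmod (?f n \<zeta> - (LINT x|lborel. ?p \<zeta> x)) = cmod (LINT x|lborel. indicator (- {- real n..real n}) x *\<^sub>R ?p \<zeta> x)"
      by (metis norm_minus_commute)
    also have "\<dots> \<le> (LINT x|lborel. cmod (indicator (- {- real n..real n}) x *\<^sub>R ?p \<zeta> x))"
      by (rule integral_norm_bound)
    also have "\<dots> \<le> \<beta> n" unfolding \<beta>_def
    proof (rule integral_mono)
      show "integrable lborel (\<lambda>x. indicator (- {- real n..real n}) x *\<^sub>R B x)"
        using B by (intro integrable_mult_indicator) auto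
    qed (use integrable_norm[OF si'] pB[OF that] in \<open>auto simp: indicator_def\<close>)
    finally show ?thesis .
  qed
  have "uniform_limit (cball \<zeta>0 d) ?f (\<lambda>\<zeta>. LINT x|lborel. ?p \<zeta> x) sequentially"
  proof (rule uniform_limitI)
    fix e :: real assume "e > 0"
    with \<beta>0 have "\<forall>\<^sub>F n in sequentially. \<beta> n < e" by (rule order_tendstoD)
    then show "\<forall>\<^sub>F n in sequentially. \<forall>\<zeta>\<in>cball \<zeta>0 d. dist (?f n \<zeta>) (LINT x|lborel. ?p \<zeta> x) < e"
    proof eventually_elim
      case (elim n)
      show ?case unfolding dist_norm by (intro ballI le_less_trans[OF bd elim])
    qed
  qed
  with d show "\<exists>d>0. cball \<zeta>0 d \<subseteq> S \<and> uniform_limit (cball \<zeta>0 d) ?f (\<lambda>\<zeta>. LINT x|lborel. ?p \<zeta> x) sequentially"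
    by (intro exI[of _ d] conjI)
qed

lemma Re_divide_pos: "Re z > 0 \<Longrightarrow> r > 0 \<Longrightarrow> Re (of_real r / z) > 0"
  by (simp add: Re_divide divide_pos_pos sum_power2_gt_zero_iff)

text \<open>Both sides are holomorphic along the complex line through \<open>(Re z, Re w)\<close> and \<open>(z, w)\<close>, whose real
  points carry the real Gaussian integral.\<close>

lemma gaussian_integral:
  assumes "Re z > 0"
  shows "(LINT x|lborel. gauss z w x) = csqrt (of_real pi / z) * exp (w\<^sup>2 / (4 * z))"
proof -
  let ?z = "\<lambda>\<zeta>. of_real (Re z) + \<zeta> * of_real (Im z)" and ?w = "\<lambda>\<zeta>. of_real (Re w) + \<zeta> * of_real (Im w)"
  define S where "S = {\<zeta>. Re (?z \<zeta>) > 0}"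
  define D where "D \<zeta> = (LINT x|lborel. gauss (?z \<zeta>) (?w \<zeta>) x)
    - csqrt (of_real pi / ?z \<zeta>) * exp ((?w \<zeta>)\<^sup>2 / (4 * ?z \<zeta>))" for \<zeta>
  have S: "open S" unfolding S_def by (intro open_Collect_less continuous_intros)
  have S_eq: "S = {\<zeta>. complex_of_real (Im z) \<bullet> \<zeta> > - Re z}"
    by (auto simp: S_def inner_complex_def algebra_simps)
  have nz: "?z \<zeta> \<noteq> 0" if "\<zeta> \<in> S" for \<zeta> using that unfolding S_def by fastforce
  \<comment> \<open>The argument of \<open>csqrt\<close> stays off the branch cut, so the right-hand
    side is holomorphic on \<open>S\<close>.\<close>
  have np: "of_real pi / ?z \<zeta> \<notin> \<real>\<^sub>\<le>\<^sub>0" if "\<zeta> \<in> S" for \<zeta>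
  proof -
    have "Re (of_real pi / ?z \<zeta>) > 0"
      using that unfolding S_def mem_Collect_eq by (rule Re_divide_pos) simp
    then show ?thesis by (auto simp: complex_nonpos_Reals_iff)
  qed
  have D0: "D \<i> = 0"
  proof (rule analytic_continuation[where f = D and S = S and w = \<i> and U = "{\<zeta> \<in> S. Im \<zeta> = 0}" and \<xi> = 0])
    have "(\<lambda>\<zeta>. csqrt (of_real pi / ?z \<zeta>) * exp ((?w \<zeta>)\<^sup>2 / (4 * ?z \<zeta>))) holomorphic_on S"
      using nz np by (intro holomorphic_intros) (simp_all add: distrib_left[symmetric] del: distrib_left_numeral)
    moreover have "(\<lambda>\<zeta>. LINT x|lborel. gauss (?z \<zeta>) (?w \<zeta>) x) holomorphic_on S"
      unfolding S_def by (rule holomorphic_gaussian_integral)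
    ultimately show "D holomorphic_on S"
      unfolding D_def by (intro holomorphic_on_diff)
    show "connected S" unfolding S_eq by (intro convex_connected convex_halfspace_gt)
    show "0 islimpt {\<zeta> \<in> S. Im \<zeta> = 0}"
      unfolding islimpt_approachable
    proof (intro allI impI)
      fix e :: real assume "e > 0"
      have "0 \<in> S" using assms by (simp add: S_def)
      with S obtain d where "d > 0" "ball 0 d \<subseteq> S" using open_contains_ball by blast
      then show "\<exists>x'\<in>{\<zeta> \<in> S. Im \<zeta> = 0}. x' \<noteq> 0 \<and> dist x' 0 < e"
        using \<open>e > 0\<close> by (intro bexI[of _ "of_real (min d e / 2)"]) (auto simp: subset_eq)
    qed
    fix \<zeta> assume "\<zeta> \<in> {\<zeta> \<in> S. Im \<zeta> = 0}"
    then obtain t where t: "\<zeta> = of_real t" "of_real t \<in> S" by (metis (mono_tags, lifting) complex_is_Real_iff mem_Collect_eq of_real_Re)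
    define s where "s = Re z + t * Im z"
    define u where "u = Re w + t * Im w"
    have zw: "?z \<zeta> = of_real s" "?w \<zeta> = of_real u" and s: "s > 0"
      using t by (auto simp: s_def u_def S_def)
    have "(LINT x|lborel. gauss (of_real s) (of_real u) x) = of_real (LINT x|lborel. exp (- s * x\<^sup>2 + u * x))"
      unfolding integral_complex_of_real[symmetric] by (simp add: gauss_def exp_of_real flip: exp_of_real)
    also have "\<dots> = of_real (sqrt (pi / s) * exp (u\<^sup>2 / (4 * s)))"
      unfolding has_bochner_integral_integral_eq[OF real_gaussian_integral[OF s]] ..
    also have "\<dots> = csqrt (of_real pi / of_real s) * exp ((of_real u)\<^sup>2 / (4 * of_real s))"
      using s by (simp add: exp_of_real[symmetric] csqrt_of_real_nonneg flip: of_real_divide) simp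
    finally show "D \<zeta> = 0" unfolding D_def zw by simp
  next
    show "\<i> \<in> S" "0 \<in> S" using assms by (simp_all add: S_def)
  qed (use S in auto)
  have "?z \<i> = z" "?w \<i> = w" by (simp_all add: complex_eq_iff)
  with D0 show ?thesis unfolding D_def by simp
qed

section \<open>Principal square roots in the right half plane\<close>

text \<open>The real part of \<open>x\<close> is the difference of the squares of the two parts of
  its root. Geometrically, the root has argument strictly between -pi/4 and pi/4.\<close>

lemma abs_Im_csqrt_less_Re_csqrt:
  assumes "Re x > 0"
  shows "\<bar>Im (csqrt x)\<bar> < Re (csqrt x)"
proof -
  have "(Im (csqrt x))\<^sup>2 < (Re (csqrt x))\<^sup>2"
    using assms power2_csqrt[of x] by (metis Re_power2 diff_gt_0_iff_gt)
  then show ?thesis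
    using Re_csqrt[of x] by (metis abs_of_nonneg power2_abs power2_less_imp_less)
qed

lemma Re_csqrt_mult_pos:
  assumes "Re x > 0" "Re y > 0"
  shows "Re (csqrt x * csqrt y) > 0"
proof -
  have "\<bar>Im (csqrt x)\<bar> * \<bar>Im (csqrt y)\<bar> < Re (csqrt x) * Re (csqrt y)"
    using abs_Im_csqrt_less_Re_csqrt[OF assms(1)] abs_Im_csqrt_less_Re_csqrt[OF assms(2)]
    by (rule mult_strict_mono'[OF _ _ abs_ge_zero abs_ge_zero])
  then show ?thesis by (simp add: abs_mult[symmetric] del: csqrt.sel)
qed

text \<open>The two products have equal squares, hence agree up to sign; both have positive real
  part, which excludes the minus sign. This settles every branch question in the composition
  formulas.\<close>

lemma csqrt_mult_right_half_plane:
  assumes "Re x > 0" "Re y > 0" "Re u > 0" "Re v > 0" "x * y = u * v"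
  shows "csqrt x * csqrt y = csqrt u * csqrt v"
proof -
  have "(csqrt x * csqrt y)\<^sup>2 = (csqrt u * csqrt v)\<^sup>2"
    using assms(5) by (simp add: power_mult_distrib)
  then show ?thesis
    using Re_csqrt_mult_pos[OF assms(1,2)] Re_csqrt_mult_pos[OF assms(3,4)]
    unfolding power2_eq_iff by fastforce
qed

section \<open>Chirp kernels on the space of square integrable functions\<close>

text \<open>One coefficient \<open>a\<close> serves both squares because the Lagrangians are
  symmetric. Exchanging the arguments therefore changes nothing, and a backward kernel is the mere
  conjugate of a forward one.\<close>

definition chirp :: "complex \<Rightarrow> real \<Rightarrow> real \<Rightarrow> real \<Rightarrow> real \<Rightarrow> complex" where
  "chirp c a \<alpha> x y = c * exp (\<i> * of_real (a * x\<^sup>2 + \<alpha> * x * y + a * y\<^sup>2))"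

lemma cmod_chirp [simp]: "cmod (chirp c a \<alpha> x y) = cmod c"
  by (simp add: chirp_def norm_mult)

lemma chirp_commute: "chirp c a \<alpha> x y = chirp c a \<alpha> y x"
  by (simp add: chirp_def algebra_simps)

lemma measurable_chirp [measurable]: "(\<lambda>(x, y). chirp c a \<alpha> x y) \<in> borel_measurable (borel \<Otimes>\<^sub>M borel)"
  unfolding chirp_def by measurable

lemma measurable_chirp' [measurable (raw)]:
  assumes [measurable]: "f \<in> borel_measurable M" "g \<in> borel_measurable M"
  shows "(\<lambda>t. chirp c a \<alpha> (f t) (g t)) \<in> borel_measurable M"
  unfolding chirp_def by measurable

section \<open>The Plancherel type bound and completeness in L2\<close>

text \<open>The modulus of the double integrand is at most
  \<open>C * cmod (u x) * cmod (v y)\<close>, which is integrable over the plane.\<close>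

lemma Fubini_bounded_kernel:
  fixes B :: "real \<Rightarrow> real \<Rightarrow> complex" and u v :: "real \<Rightarrow> complex"
  assumes [measurable]: "(\<lambda>(x, y). B x y) \<in> borel_measurable (borel \<Otimes>\<^sub>M borel)"
    and B: "\<And>x y. cmod (B x y) \<le> C"
    and u: "integrable lborel u" and v: "integrable lborel v"
  shows "(LINT x|lborel. u x * (LINT y|lborel. B x y * v y)) = (LINT y|lborel. v y * (LINT x|lborel. B x y * u x))"
proof -
  have [measurable]: "u \<in> borel_measurable borel" "v \<in> borel_measurable borel"
    using u v by (auto dest: borel_measurable_integrable)
  have C: "C \<ge> 0" using B[of 0 0] norm_ge_zero order_trans by blast
  have i: "integrable lborel (\<lambda>y. u x * (B x y * v y))" for x
  proof (rule Bochner_Integration.integrable_bound)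
    show "integrable lborel (\<lambda>y. cmod (u x) * (C * cmod (v y)))" using v by simp
    show "AE y in lborel. norm (u x * (B x y * v y)) \<le> norm (cmod (u x) * (C * cmod (v y)))"
      using B C by (auto simp: norm_mult intro!: mult_left_mono mult_right_mono)
  qed measurable
  have "integrable (lborel \<Otimes>\<^sub>M lborel) (\<lambda>(x, y). u x * (B x y * v y))"
  proof (rule lborel_pair.Fubini_integrable)
    show "integrable lborel (\<lambda>x. LINT y|lborel. norm (case (x, y) of (x, y) \<Rightarrow> u x * (B x y * v y)))"
    proof (rule Bochner_Integration.integrable_bound)
      show "integrable lborel (\<lambda>x. cmod (u x) * (C * (LINT y|lborel. cmod (v y))))" using u by simp
      show "AE x in lborel. norm (LINT y|lborel. norm (case (x, y) of (x, y) \<Rightarrow> u x * (B x y * v y)))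
        \<le> norm (cmod (u x) * (C * (LINT y|lborel. cmod (v y))))"
      proof (rule AE_I2)
        fix x
        have "(LINT y|lborel. norm (u x * (B x y * v y))) \<le> (LINT y|lborel. cmod (u x) * (C * cmod (v y)))"
          using i[of x] v B C
          by (intro integral_mono integrable_norm) (auto simp: norm_mult intro!: mult_left_mono mult_right_mono)
        then show "norm (LINT y|lborel. norm (case (x, y) of (x, y) \<Rightarrow> u x * (B x y * v y)))
           \<le> norm (cmod (u x) * (C * (LINT y|lborel. cmod (v y))))"
          using C by simp
      qed
    qed measurable
  qed (use i in auto)
  from lborel_pair.Fubini_integral[OF this]
  have "(LINT x|lborel. LINT y|lborel. u x * (B x y * v y)) = (LINT y|lborel. LINT x|lborel. v y * (B x y * u x))"
    by (simp add: mult_ac)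
  then show ?thesis by simp
qed

text \<open>If \<open>f\<close> is not integrable, its Bochner integral is 0 by convention and the
  bound is trivial.\<close>

lemma norm_integral_le_nn_integral:
  fixes f :: "'a \<Rightarrow> 'b :: {banach, second_countable_topology}"
  shows "ennreal (norm (integral\<^sup>L M f)) \<le> (\<integral>\<^sup>+x. ennreal (norm (f x)) \<partial>M)"
  by (cases "integrable M f") (auto simp: integral_norm_bound_ennreal not_integrable_integral_eq)

text \<open>Schur's test: the product of the two moduli of \<open>h\<close> is at most half the sum
  of their squares, and by translation invariance and evenness every row and column of
  \<open>G (x - x')\<close> has the same mass.\<close>

lemma Schur_bound_convolution:
  fixes h :: "real \<Rightarrow> complex" and G :: "real \<Rightarrow> real"
  assumes [measurable]: "h \<in> borel_measurable borel" "G \<in> borel_measurable borel"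
    and G: "\<And>t. G t \<ge> 0" and even: "\<And>t. G (- t) = G t"
  shows "(\<integral>\<^sup>+x. ennreal (cmod (h x)) * (\<integral>\<^sup>+x'. ennreal (cmod (h x')) * ennreal (G (x - x')) \<partial>lborel) \<partial>lborel)
    \<le> (\<integral>\<^sup>+t. ennreal (G t) \<partial>lborel) * (\<integral>\<^sup>+x. ennreal ((cmod (h x))\<^sup>2) \<partial>lborel)"
proof -
  let ?g = "\<integral>\<^sup>+t. ennreal (G t) \<partial>lborel" and ?H = "\<integral>\<^sup>+x. ennreal ((cmod (h x))\<^sup>2) \<partial>lborel"
  have conv: "(\<integral>\<^sup>+x'. ennreal (G (x - x')) \<partial>lborel) = ?g" for x
  proof -
    have "?g = (\<integral>\<^sup>+x'. ennreal (G (- x + 1 * x')) \<partial>lborel)"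
      using nn_integral_real_affine[of "\<lambda>t. ennreal (G t)" 1 "- x"] by simp
    also have "\<dots> = (\<integral>\<^sup>+x'. ennreal (G (x - x')) \<partial>lborel)"
      using even[of "x - _"] by (intro nn_integral_cong) (simp add: algebra_simps)
    finally show ?thesis ..
  qed
  have "(\<integral>\<^sup>+x. ennreal (cmod (h x)) * (\<integral>\<^sup>+x'. ennreal (cmod (h x')) * ennreal (G (x - x')) \<partial>lborel) \<partial>lborel)
     = (\<integral>\<^sup>+x. \<integral>\<^sup>+x'. ennreal (cmod (h x) * (cmod (h x') * G (x - x'))) \<partial>lborel \<partial>lborel)"
    by (simp add: nn_integral_cmult[symmetric] ennreal_mult G)
  also have "\<dots> \<le> (\<integral>\<^sup>+x. \<integral>\<^sup>+x'. ennreal (1/2 * (cmod (h x))\<^sup>2) * ennreal (G (x - x'))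
       + ennreal (1/2 * (cmod (h x'))\<^sup>2) * ennreal (G (x' - x)) \<partial>lborel \<partial>lborel)"
  proof (intro nn_integral_mono)
    fix x x'
    have "cmod (h x) * cmod (h x') \<le> 1/2 * (cmod (h x))\<^sup>2 + 1/2 * (cmod (h x'))\<^sup>2"
      using sum_squares_bound[of "cmod (h x)" "cmod (h x')"] by simp
    from mult_right_mono[OF this G[of "x - x'"]]
    have "cmod (h x) * (cmod (h x') * G (x - x')) \<le> 1/2 * (cmod (h x))\<^sup>2 * G (x - x') + 1/2 * (cmod (h x'))\<^sup>2 * G (x' - x)"
      using even[of "x - x'"] by (simp add: algebra_simps)
    then show "ennreal (cmod (h x) * (cmod (h x') * G (x - x'))) \<le>
      ennreal (1/2 * (cmod (h x))\<^sup>2) * ennreal (G (x - x')) + ennreal (1/2 * (cmod (h x'))\<^sup>2) * ennreal (G (x' - x))"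
      using G by (simp add: ennreal_mult[symmetric] ennreal_plus[symmetric] ennreal_leI del: ennreal_plus)
  qed
  also have "\<dots> = (\<integral>\<^sup>+x. \<integral>\<^sup>+x'. ennreal (1/2 * (cmod (h x))\<^sup>2) * ennreal (G (x - x')) \<partial>lborel \<partial>lborel)
      + (\<integral>\<^sup>+x. \<integral>\<^sup>+x'. ennreal (1/2 * (cmod (h x'))\<^sup>2) * ennreal (G (x' - x)) \<partial>lborel \<partial>lborel)"
    by (simp add: nn_integral_add)
  also have "(\<integral>\<^sup>+x. \<integral>\<^sup>+x'. ennreal (1/2 * (cmod (h x'))\<^sup>2) * ennreal (G (x' - x)) \<partial>lborel \<partial>lborel)
     = (\<integral>\<^sup>+x'. \<integral>\<^sup>+x. ennreal (1/2 * (cmod (h x'))\<^sup>2) * ennreal (G (x' - x)) \<partial>lborel \<partial>lborel)"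
    by (rule lborel_pair.Fubini') measurable
  also have "(\<integral>\<^sup>+x. \<integral>\<^sup>+x'. ennreal (1/2 * (cmod (h x))\<^sup>2) * ennreal (G (x - x')) \<partial>lborel \<partial>lborel)
     = ennreal (1/2) * (?g * ?H)"
  proof -
    have "(\<integral>\<^sup>+x. \<integral>\<^sup>+x'. ennreal (1/2 * (cmod (h x))\<^sup>2) * ennreal (G (x - x')) \<partial>lborel \<partial>lborel)
      = (\<integral>\<^sup>+x. ennreal (1/2) * ?g * ennreal ((cmod (h x))\<^sup>2) \<partial>lborel)"
      by (intro nn_integral_cong, subst nn_integral_cmult) (simp_all only: conv ennreal_mult ennreal_mult' mult_ac, simp_all)
    also have "\<dots> = ennreal (1/2) * (?g * ?H)"
      by (simp add: nn_integral_cmult mult.assoc)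
    finally show ?thesis .
  qed
  also have "ennreal (1/2) * (?g * ?H) + ennreal (1/2) * (?g * ?H) = ?g * ?H"
  proof -
    have "ennreal (1/2) + ennreal (1/2) = 1"
      by (subst ennreal_plus[symmetric]) simp_all
    then show ?thesis unfolding distrib_right[symmetric] by simp
  qed
  finally show ?thesis .
qed

lemma measurable_cnj [measurable (raw)]:
  "f \<in> borel_measurable M \<Longrightarrow> (\<lambda>x. cnj (f x)) \<in> borel_measurable M"
  by (rule measurable_compose[OF _ borel_measurable_continuous_onI]) (auto intro: continuous_intros)

text \<open>In the product with the conjugate the terms \<open>a * y\<^sup>2\<close> cancel. What
  remains in \<open>y\<close> is a Gaussian of parameter \<open>\<epsilon>\<close> with frequency
  \<open>\<alpha> * (x - x')\<close>, apart from a factor of modulus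
  \<open>(cmod c)\<^sup>2\<close>.\<close>

lemma integral_conj_chirp_damped:
  assumes "\<epsilon> > 0"
  shows "cmod (LINT y|lborel. cnj (chirp c a \<alpha> x' y) * (chirp c a \<alpha> x y * of_real (exp (- \<epsilon> * y\<^sup>2))))
    = (cmod c)\<^sup>2 * (sqrt (pi / \<epsilon>) * exp (- (\<alpha>\<^sup>2 / (4 * \<epsilon>)) * (x - x')\<^sup>2))"
proof -
  let ?k = "c * cnj c * exp (\<i> * of_real (a * x\<^sup>2 - a * x'\<^sup>2))"
  have "cnj (chirp c a \<alpha> x' y) * (chirp c a \<alpha> x y * of_real (exp (- \<epsilon> * y\<^sup>2)))
     = ?k * gauss (of_real \<epsilon>) (\<i> * of_real (\<alpha> * (x - x'))) y" for y
  proof -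
    have "exp (- (\<i> * of_real (a * x'\<^sup>2 + \<alpha> * x' * y + a * y\<^sup>2))) *
        (exp (\<i> * of_real (a * x\<^sup>2 + \<alpha> * x * y + a * y\<^sup>2)) * exp (of_real (- \<epsilon> * y\<^sup>2)))
      = exp (\<i> * of_real (a * x\<^sup>2 - a * x'\<^sup>2)) * exp (- of_real \<epsilon> * (of_real y)\<^sup>2 + \<i> * of_real (\<alpha> * (x - x')) * of_real y)"
      unfolding exp_add[symmetric] by (rule arg_cong[where f = exp]) (simp add: algebra_simps)
    then show ?thesis
      by (simp add: chirp_def gauss_def exp_cnj exp_of_real[symmetric] mult_ac del: exp_of_real)
  qed
  then have "(LINT y|lborel. cnj (chirp c a \<alpha> x' y) * (chirp c a \<alpha> x y * of_real (exp (- \<epsilon> * y\<^sup>2))))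
     = ?k * (csqrt (of_real pi / of_real \<epsilon>) * exp ((\<i> * of_real (\<alpha> * (x - x')))\<^sup>2 / (4 * of_real \<epsilon>)))"
    using assms by (simp add: gaussian_integral)
  moreover have "cmod ?k = (cmod c)\<^sup>2" by (simp add: norm_mult power2_eq_square)
  moreover have "cmod (csqrt (of_real pi / of_real \<epsilon>)) = sqrt (pi / \<epsilon>)"
    using assms by (simp add: csqrt_of_real_nonneg flip: of_real_divide)
  moreover have "cmod (exp ((\<i> * of_real (\<alpha> * (x - x')))\<^sup>2 / (4 * of_real \<epsilon>))) = exp (- (\<alpha>\<^sup>2 / (4 * \<epsilon>)) * (x - x')\<^sup>2)"
  proof -
    have "(\<i> * of_real (\<alpha> * (x - x')))\<^sup>2 / (4 * of_real \<epsilon>) = complex_of_real (- (\<alpha>\<^sup>2 / (4 * \<epsilon>)) * (x - x')\<^sup>2)"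
      by (simp add: power_mult_distrib)
    then show ?thesis by (metis Re_complex_of_real norm_exp_eq_Re)
  qed
  ultimately show ?thesis by (simp only: norm_mult)
qed

text \<open>The weight \<open>exp (- \<epsilon> y\<^sup>2)\<close> makes Fubini's theorem applicable: expanding the square yields the
  Gaussian kernel of \<open>integral_conj_chirp_damped\<close>, whose \<open>L\<^sup>1\<close> norm does not depend on \<open>\<epsilon>\<close>, so that Schur's
  test gives a bound that survives \<open>\<epsilon> \<rightarrow> 0\<close>.\<close>

lemma chirp_L2_bound_damped:
  fixes h :: "real \<Rightarrow> complex"
  assumes h: "integrable lborel h" and \<alpha>: "\<alpha> \<noteq> 0" and \<epsilon>: "\<epsilon> > 0"
  shows "(\<integral>\<^sup>+y. ennreal (exp (- \<epsilon> * y\<^sup>2) * (cmod (LINT x|lborel. chirp c a \<alpha> x y * h x))\<^sup>2) \<partial>lborel)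
    \<le> ennreal ((cmod c)\<^sup>2 * (2 * pi / \<bar>\<alpha>\<bar>)) * (\<integral>\<^sup>+x. ennreal ((cmod (h x))\<^sup>2) \<partial>lborel)"
proof -
  have [measurable]: "h \<in> borel_measurable borel" using h by (auto dest: borel_measurable_integrable)
  define H where "H y = (LINT x|lborel. chirp c a \<alpha> x y * h x)" for y
  have [measurable]: "H \<in> borel_measurable borel" unfolding H_def by measurable
  define b where "b y = exp (- \<epsilon> * y\<^sup>2)" for y :: real
  have [measurable]: "b \<in> borel_measurable borel" unfolding b_def by measurable
  have b_pos: "b y \<ge> 0" for y by (simp add: b_def)
  have b_int: "integrable lborel b"
    unfolding b_def using integrable.intros[OF real_gaussian_integral[OF \<epsilon>, of 0]] by simp
  define D where "D = (LINT x|lborel. cmod c * cmod (h x))"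
  have D0: "D \<ge> 0" by (simp add: D_def)
  have H_bd: "cmod (H y) \<le> D" for y
    using integral_norm_bound[of lborel "\<lambda>x. chirp c a \<alpha> x y * h x"]
    unfolding H_def D_def by (simp add: norm_mult)
  \<comment> \<open>Chosen so that \<open>v y * H y\<close> is the weighted square of the modulus of
    \<open>H\<close>; the factor \<open>b\<close> makes \<open>v\<close> integrable, as Fubini
    requires.\<close>
  define v where "v y = of_real (b y) * cnj (H y)" for y
  have v_int: "integrable lborel v"
  proof (rule Bochner_Integration.integrable_bound)
    show "integrable lborel (\<lambda>y. b y * D)" using b_int by simp
    show "v \<in> borel_measurable lborel" unfolding v_def by measurable
  qed (use b_pos H_bd D0 in \<open>auto simp: v_def norm_mult intro!: mult_left_mono\<close>)
  have cb_int: "integrable lborel (\<lambda>y. chirp c a \<alpha> x y * of_real (b y))" for x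
    by (rule Bochner_Integration.integrable_bound[of _ "\<lambda>y. cmod c * b y"]) (use b_int b_pos in \<open>auto simp: norm_mult\<close>)
  define G where "G t = (cmod c)\<^sup>2 * (sqrt (pi / \<epsilon>) * exp (- (\<alpha>\<^sup>2 / (4 * \<epsilon>)) * t\<^sup>2))" for t
  have [measurable]: "G \<in> borel_measurable borel" unfolding G_def by measurable
  have G0: "G t \<ge> 0" for t using \<epsilon> by (simp add: G_def)
  have G_even: "G (- t) = G t" for t by (simp add: G_def)
  have "\<alpha>\<^sup>2 / (4 * \<epsilon>) > 0" using \<alpha> \<epsilon> by simp
  from has_bochner_integral_mult_right[of "(cmod c)\<^sup>2 * sqrt (pi / \<epsilon>)", OF real_gaussian_integral[OF this, of 0]]
  have G: "has_bochner_integral lborel G ((cmod c)\<^sup>2 * sqrt (pi / \<epsilon>) * sqrt (pi / (\<alpha>\<^sup>2 / (4 * \<epsilon>))))"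
    by (simp add: G_def[abs_def] mult.assoc)
  \<comment> \<open>Here \<open>\<epsilon>\<close> cancels: the height of \<open>G\<close> grows as
    its width shrinks, at constant mass.\<close>
  have "sqrt (pi / \<epsilon>) * sqrt (pi / (\<alpha>\<^sup>2 / (4 * \<epsilon>))) = sqrt ((2 * pi / \<bar>\<alpha>\<bar>)\<^sup>2)"
    using \<alpha> \<epsilon> unfolding real_sqrt_mult[symmetric] by (simp add: field_simps power2_eq_square)
  also have "\<dots> = 2 * pi / \<bar>\<alpha>\<bar>" by (simp add: real_sqrt_abs)
  finally have "has_bochner_integral lborel G ((cmod c)\<^sup>2 * (2 * pi / \<bar>\<alpha>\<bar>))"
    using G by (simp add: mult.assoc)
  then have G_nn: "(\<integral>\<^sup>+t. ennreal (G t) \<partial>lborel) = ennreal ((cmod c)\<^sup>2 * (2 * pi / \<bar>\<alpha>\<bar>))"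
    using G0 by (simp add: has_bochner_integral_iff nn_integral_eq_integral)
  have inner: "(LINT y|lborel. chirp c a \<alpha> x y * v y)
     = (LINT x'|lborel. cnj (h x') * (LINT y|lborel. cnj (chirp c a \<alpha> x' y) * (chirp c a \<alpha> x y * of_real (b y))))" for x
  proof -
    have "cnj (H y) = (LINT x'|lborel. cnj (chirp c a \<alpha> x' y) * cnj (h x'))" for y
      unfolding H_def by (simp flip: complex_cnj_mult)
    then have "(LINT y|lborel. chirp c a \<alpha> x y * v y)
      = (LINT y|lborel. (chirp c a \<alpha> x y * of_real (b y)) * (LINT x'|lborel. cnj (chirp c a \<alpha> x' y) * cnj (h x')))"
      by (simp add: v_def mult.assoc)
    also have "\<dots> = (LINT x'|lborel. cnj (h x') * (LINT y|lborel. cnj (chirp c a \<alpha> x' y) * (chirp c a \<alpha> x y * of_real (b y))))"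
      by (rule Fubini_bounded_kernel[symmetric, where C = "cmod c"]) (use h cb_int in \<open>auto simp: split_def\<close>)
    finally show ?thesis .
  qed
  have inner_bd: "ennreal (cmod (LINT y|lborel. chirp c a \<alpha> x y * v y))
     \<le> (\<integral>\<^sup>+x'. ennreal (cmod (h x')) * ennreal (G (x - x')) \<partial>lborel)" for x
  proof -
    have "cmod (LINT y|lborel. cnj (chirp c a \<alpha> x' y) * (chirp c a \<alpha> x y * of_real (b y))) = G (x - x')" for x'
      unfolding b_def G_def by (rule integral_conj_chirp_damped[OF \<epsilon>])
    then show ?thesis unfolding inner
      by (intro order_trans[OF norm_integral_le_nn_integral]) (simp add: norm_mult ennreal_mult G0)
  qed
  have vH: "v y * H y = of_real (b y * (cmod (H y))\<^sup>2)" for y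
    unfolding v_def of_real_mult complex_norm_square by (simp only: mult_ac)
  have vH_int: "integrable lborel (\<lambda>y. b y * (cmod (H y))\<^sup>2)"
    by (rule Bochner_Integration.integrable_bound[of _ "\<lambda>y. b y * D\<^sup>2"])
       (use b_int b_pos H_bd D0 in \<open>auto intro!: mult_left_mono power_mono\<close>)
  have "(\<integral>\<^sup>+y. ennreal (b y * (cmod (H y))\<^sup>2) \<partial>lborel) = ennreal (LINT y|lborel. b y * (cmod (H y))\<^sup>2)"
    using vH_int b_pos by (intro nn_integral_eq_integral) auto
  also have "(LINT y|lborel. b y * (cmod (H y))\<^sup>2) = cmod (LINT y|lborel. v y * H y)"
    unfolding vH integral_complex_of_real by (simp add: b_pos)
  also have "(LINT y|lborel. v y * H y) = (LINT x|lborel. h x * (LINT y|lborel. chirp c a \<alpha> x y * v y))"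
    unfolding H_def
    by (rule Fubini_bounded_kernel[symmetric, where C = "cmod c"]) (use h v_int in auto)
  also have "ennreal (cmod \<dots>) \<le> (\<integral>\<^sup>+x. ennreal (cmod (h x)) * ennreal (cmod (LINT y|lborel. chirp c a \<alpha> x y * v y)) \<partial>lborel)"
    by (rule order_trans[OF norm_integral_le_nn_integral]) (simp add: norm_mult ennreal_mult)
  also have "\<dots> \<le> (\<integral>\<^sup>+x. ennreal (cmod (h x)) * (\<integral>\<^sup>+x'. ennreal (cmod (h x')) * ennreal (G (x - x')) \<partial>lborel) \<partial>lborel)"
    by (intro nn_integral_mono mult_left_mono inner_bd) simp
  also have "\<dots> \<le> (\<integral>\<^sup>+t. ennreal (G t) \<partial>lborel) * (\<integral>\<^sup>+x. ennreal ((cmod (h x))\<^sup>2) \<partial>lborel)"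
    by (rule Schur_bound_convolution) (auto simp: G0 G_even)
  finally show ?thesis unfolding G_nn H_def b_def .
qed

text \<open>Fatou's lemma along \<open>\<epsilon>\<close> = 1/(n+1) removes the weight from the
  damped bound.\<close>

lemma chirp_L2_bound:
  fixes h :: "real \<Rightarrow> complex"
  assumes h: "integrable lborel h" and \<alpha>: "\<alpha> \<noteq> 0"
  shows "(\<integral>\<^sup>+y. ennreal ((cmod (LINT x|lborel. chirp c a \<alpha> x y * h x))\<^sup>2) \<partial>lborel)
    \<le> ennreal ((cmod c)\<^sup>2 * (2 * pi / \<bar>\<alpha>\<bar>)) * (\<integral>\<^sup>+x. ennreal ((cmod (h x))\<^sup>2) \<partial>lborel)"
proof -
  have [measurable]: "h \<in> borel_measurable borel" using h by (auto dest: borel_measurable_integrable)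
  let ?H = "\<lambda>y. (cmod (LINT x|lborel. chirp c a \<alpha> x y * h x))\<^sup>2"
  let ?\<epsilon> = "\<lambda>n. inverse (real (Suc n))"
  have lim: "(\<lambda>n. ennreal (exp (- ?\<epsilon> n * y\<^sup>2) * ?H y)) \<longlonglongrightarrow> ennreal (?H y)" for y
  proof (intro tendsto_ennrealI)
    have "(\<lambda>n. exp (- ?\<epsilon> n * y\<^sup>2) * ?H y) \<longlonglongrightarrow> exp (- 0 * y\<^sup>2) * ?H y"
      by (intro tendsto_intros LIMSEQ_inverse_real_of_nat)
    then show "(\<lambda>n. exp (- ?\<epsilon> n * y\<^sup>2) * ?H y) \<longlonglongrightarrow> ?H y" by simp
  qed
  have "(\<integral>\<^sup>+y. ennreal (?H y) \<partial>lborel) = (\<integral>\<^sup>+y. liminf (\<lambda>n. ennreal (exp (- ?\<epsilon> n * y\<^sup>2) * ?H y)) \<partial>lborel)"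
    using lim_imp_Liminf[OF sequentially_bot lim] by simp
  also have "\<dots> \<le> liminf (\<lambda>n. \<integral>\<^sup>+y. ennreal (exp (- ?\<epsilon> n * y\<^sup>2) * ?H y) \<partial>lborel)"
    by (rule nn_integral_liminf) measurable
  also have "\<dots> \<le> ennreal ((cmod c)\<^sup>2 * (2 * pi / \<bar>\<alpha>\<bar>)) * (\<integral>\<^sup>+x. ennreal ((cmod (h x))\<^sup>2) \<partial>lborel)"
  proof -
    have "liminf (\<lambda>n. \<integral>\<^sup>+y. ennreal (exp (- ?\<epsilon> n * y\<^sup>2) * ?H y) \<partial>lborel)
      \<le> liminf (\<lambda>n::nat. ennreal ((cmod c)\<^sup>2 * (2 * pi / \<bar>\<alpha>\<bar>)) * (\<integral>\<^sup>+x. ennreal ((cmod (h x))\<^sup>2) \<partial>lborel))"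
      by (intro Liminf_mono always_eventually allI chirp_L2_bound_damped h \<alpha>) simp
    then show ?thesis by (simp add: Liminf_const)
  qed
  finally show ?thesis .
qed

text \<open>Along a fast subsequence the increments are summable almost everywhere; Fatou's lemma then compares
  the pointwise limit with every \<open>G N\<close>, not only with the members of the subsequence.\<close>

lemma L2_limit_exists:
  fixes G :: "real \<Rightarrow> real \<Rightarrow> complex" and \<tau> :: "real \<Rightarrow> ennreal"
  assumes [measurable]: "\<And>N. G N \<in> borel_measurable lborel"
    and bd: "\<And>M N. 0 \<le> N \<Longrightarrow> N \<le> M \<Longrightarrow> (\<integral>\<^sup>+y. ennreal ((cmod (G M y - G N y))\<^sup>2) \<partial>lborel) \<le> \<tau> N"
    and \<tau>: "(\<tau> \<longlongrightarrow> 0) at_top"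
  obtains g where "g \<in> borel_measurable lborel"
    "\<And>N. 0 \<le> N \<Longrightarrow> (\<integral>\<^sup>+y. ennreal ((cmod (g y - G N y))\<^sup>2) \<partial>lborel) \<le> \<tau> N"
proof -
  \<comment> \<open>The level \<open>(1/4) ^ k\<close> is small enough that \<open>(1/2) ^ k\<close>
    is left after multiplication by the weight \<open>2 ^ k\<close> used below.\<close>
  have "\<exists>N0. \<forall>N\<ge>N0. \<tau> N < ennreal ((1/4) ^ k)" for k
    using order_tendstoD(2)[OF \<tau>, of "ennreal ((1/4) ^ k)"] by (simp add: eventually_at_top_linorder)
  then obtain N0 where N0: "\<And>k N. N \<ge> N0 k \<Longrightarrow> \<tau> N < ennreal ((1/4) ^ k)" by metis
  \<comment> \<open>The summand \<open>real k\<close> drives \<open>n\<close> to infinity; the sum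
    of absolute values makes \<open>n\<close> increasing and at least \<open>N0 k\<close>.\<close>
  define n where "n k = real k + (\<Sum>j\<le>k. \<bar>N0 j\<bar>)" for k
  have n_ge: "n k \<ge> real k" for k by (simp add: n_def sum_nonneg)
  have n_Suc: "n k \<le> n (Suc k)" for k by (simp add: n_def)
  have \<tau>n: "\<tau> (n k) \<le> ennreal ((1/4) ^ k)" for k
  proof -
    have "\<bar>N0 k\<bar> \<le> (\<Sum>j\<le>k. \<bar>N0 j\<bar>)" by (rule member_le_sum) auto
    then have "n k \<ge> N0 k" unfolding n_def by linarith
    then show ?thesis using N0 less_imp_le by blast
  qed
  define d where "d k y = cmod (G (n (Suc k)) y - G (n k) y)" for k y
  have [measurable]: "d k \<in> borel_measurable lborel" for k unfolding d_def by measurable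
  have "(\<integral>\<^sup>+y. (\<Sum>k. ennreal (2 ^ k * (d k y)\<^sup>2)) \<partial>lborel) = (\<Sum>k. \<integral>\<^sup>+y. ennreal (2 ^ k * (d k y)\<^sup>2) \<partial>lborel)"
    by (rule nn_integral_suminf) measurable
  also have "\<dots> \<le> (\<Sum>k. ennreal ((1/2) ^ k))"
  proof (rule suminf_le)
    fix k
    have "(\<integral>\<^sup>+y. ennreal (2 ^ k * (d k y)\<^sup>2) \<partial>lborel) = ennreal (2 ^ k) * (\<integral>\<^sup>+y. ennreal ((d k y)\<^sup>2) \<partial>lborel)"
      by (simp add: ennreal_mult nn_integral_cmult)
    also have "\<dots> \<le> ennreal (2 ^ k) * ennreal ((1/4) ^ k)"
      unfolding d_def using n_ge[of k] by (intro mult_left_mono order_trans[OF bd \<tau>n] n_Suc) auto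
    also have "\<dots> = ennreal ((1/2) ^ k)"
      by (simp add: ennreal_mult[symmetric] power_mult_distrib[symmetric])
    finally show "(\<integral>\<^sup>+y. ennreal (2 ^ k * (d k y)\<^sup>2) \<partial>lborel) \<le> ennreal ((1/2) ^ k)" .
  qed auto
  also have "\<dots> < \<infinity>"
  proof -
    have "(\<Sum>k. ennreal ((1/2) ^ k)) \<noteq> top"
      by (rule ennreal_suminf_neq_top) (auto intro!: summable_geometric)
    then show ?thesis unfolding infinity_ennreal_def top.not_eq_extremum .
  qed
  finally have fin: "(\<integral>\<^sup>+y. (\<Sum>k. ennreal (2 ^ k * (d k y)\<^sup>2)) \<partial>lborel) \<noteq> \<infinity>" by simp
  have "AE y in lborel. (\<Sum>k. ennreal (2 ^ k * (d k y)\<^sup>2)) \<noteq> \<infinity>"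
    by (rule nn_integral_PInf_AE[OF _ fin]) measurable
  then have conv: "AE y in lborel. convergent (\<lambda>k. G (n k) y)"
  proof eventually_elim
    case (elim y)
    have "summable (\<lambda>k. 2 ^ k * (d k y)\<^sup>2)"
      using elim by (intro summable_suminf_not_top) auto
    then have "summable (\<lambda>k. (1/2) ^ k + 2 ^ k * (d k y)\<^sup>2)"
      by (intro summable_add summable_geometric) auto
    then have "summable (\<lambda>k. d k y)"
    proof (rule summable_comparison_test'[where N = 0])
      fix k
      \<comment> \<open>The square of \<open>s * d k y - 1\<close> being nonnegative bounds
        \<open>2 * d k y\<close> by the sum of two summable terms, one geometric and one from the
        finite weighted series.\<close>
      define s :: real where "s = 2 ^ k"
      have s: "s > 0" "(1/2) ^ k = 1 / s" by (simp_all add: s_def power_one_over)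
      have "0 \<le> (s * d k y - 1)\<^sup>2 / s" using s by simp
      also have "\<dots> = s * (d k y)\<^sup>2 - 2 * d k y + 1 / s"
        using s by (simp add: field_simps power2_eq_square)
      finally have "2 * d k y \<le> (1/2) ^ k + 2 ^ k * (d k y)\<^sup>2" using s by (simp add: s_def)
      moreover have "d k y \<ge> 0" by (simp add: d_def)
      ultimately show "norm (d k y) \<le> (1/2) ^ k + 2 ^ k * (d k y)\<^sup>2" by simp
    qed
    then have "summable (\<lambda>k. G (n (Suc k)) y - G (n k) y)"
      unfolding d_def by (rule summable_norm_cancel)
    then have "convergent (\<lambda>m. \<Sum>k<m. G (n (Suc k)) y - G (n k) y)"
      by (simp add: summable_iff_convergent)
    then have "convergent (\<lambda>m. (G (n m) y - G (n 0) y) + G (n 0) y)"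
      unfolding sum_lessThan_telescope[of "\<lambda>k. G (n k) y"] by (intro convergent_add convergent_const)
    then show ?case by simp
  qed
  define g where "g y = lim (\<lambda>k. G (n k) y)" for y
  have [measurable]: "g \<in> borel_measurable lborel" unfolding g_def by measurable
  have "(\<integral>\<^sup>+y. ennreal ((cmod (g y - G N y))\<^sup>2) \<partial>lborel) \<le> \<tau> N" if "0 \<le> N" for N
  proof -
    have "AE y in lborel. ennreal ((cmod (g y - G N y))\<^sup>2) = liminf (\<lambda>k. ennreal ((cmod (G (n k) y - G N y))\<^sup>2))"
      using conv
    proof eventually_elim
      case (elim y)
      then have "(\<lambda>k. G (n k) y) \<longlonglongrightarrow> g y" unfolding g_def by (simp add: convergent_LIMSEQ_iff)
      then have "(\<lambda>k. ennreal ((cmod (G (n k) y - G N y))\<^sup>2)) \<longlonglongrightarrow> ennreal ((cmod (g y - G N y))\<^sup>2)"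
        by (intro tendsto_ennrealI tendsto_intros)
      then show ?case by (rule lim_imp_Liminf[OF sequentially_bot, symmetric])
    qed
    then have "(\<integral>\<^sup>+y. ennreal ((cmod (g y - G N y))\<^sup>2) \<partial>lborel)
       = (\<integral>\<^sup>+y. liminf (\<lambda>k. ennreal ((cmod (G (n k) y - G N y))\<^sup>2)) \<partial>lborel)"
      by (rule nn_integral_cong_AE)
    also have "\<dots> \<le> liminf (\<lambda>k. \<integral>\<^sup>+y. ennreal ((cmod (G (n k) y - G N y))\<^sup>2) \<partial>lborel)"
      by (rule nn_integral_liminf) measurable
    also have "\<dots> \<le> liminf (\<lambda>k::nat. \<tau> N)"
    proof (rule Liminf_mono)
      obtain k0 where "N \<le> real k0" using real_arch_simple by blast
      then have "N \<le> n k" if "k0 \<le> k" for k using n_ge[of k] that by linarith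
      then show "\<forall>\<^sub>F k in sequentially. (\<integral>\<^sup>+y. ennreal ((cmod (G (n k) y - G N y))\<^sup>2) \<partial>lborel) \<le> \<tau> N"
        by (intro eventually_sequentiallyI[of k0] bd that)
    qed
    also have "\<dots> = \<tau> N" by (simp add: Liminf_const)
    finally show ?thesis .
  qed
  with \<open>g \<in> borel_measurable lborel\<close> show ?thesis by (rule that)
qed

section \<open>L2 limits of truncated chirp integrals\<close>

lemma integrable_chirp_mult:
  fixes h :: "real \<Rightarrow> complex"
  assumes "integrable lborel h"
  shows "integrable lborel (\<lambda>x. chirp c a \<alpha> x y * h x)"
proof (rule Bochner_Integration.integrable_bound)
  show "integrable lborel (\<lambda>x. cmod c * cmod (h x))" using assms by simp
qed (use borel_measurable_integrable[OF assms] in \<open>auto simp: norm_mult\<close>)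

text \<open>On a bounded interval the estimate
  \<open>cmod (f x) \<le> 1 + (cmod (f x))\<^sup>2\<close> reduces integrability to that of the
  square.\<close>

lemma integrable_truncation:
  assumes "square_integrable f"
  shows "integrable lborel (\<lambda>x. indicator {-N..N::real} x *\<^sub>R f x)"
proof (rule Bochner_Integration.integrable_bound)
  have "integrable lborel (\<lambda>x. indicator {-N..N} x * 1 :: real)"
    by (cases "-N \<le> N") auto
  then show "integrable lborel (\<lambda>x. indicator {-N..N} x + (cmod (f x))\<^sup>2)"
    using assms unfolding square_integrable_def by simp
  have "cmod (f x) \<le> 1 + (cmod (f x))\<^sup>2" for x
    using sum_squares_bound[of 1 "cmod (f x)"] norm_ge_zero[of "f x"]
    unfolding power_one mult_1_right by linarith
  then show "AE x in lborel. norm (indicator {-N..N} x *\<^sub>R f x) \<le> norm (indicator {-N..N} x + (cmod (f x))\<^sup>2)"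
    by (auto simp: indicator_def)
qed (use assms in \<open>auto simp: square_integrable_def\<close>)

lemma truncated_chirp_integral:
  "(LINT x:{-N..N}|lborel. chirp c a \<alpha> x y * f x) = (LINT x|lborel. chirp c a \<alpha> x y * (indicator {-N..N} x *\<^sub>R f x))"
  unfolding set_lebesgue_integral_def by simp

text \<open>The difference of two truncations of \<open>f\<close> lives outside
  \<open>[-N, N]\<close>, so the Plancherel type bound estimates the difference of their images by
  the tail of the L2 norm of \<open>f\<close>, which tends to 0.\<close>

lemma chirp_truncated_limit:
  assumes f: "square_integrable f" and \<alpha>: "\<alpha> \<noteq> 0"
  obtains g where "square_integrable g"
    "((\<lambda>N::real. \<integral>\<^sup>+y. ennreal ((cmod (g y - (LINT x:{-N..N}|lborel. chirp c a \<alpha> x y * f x)))\<^sup>2) \<partial>lborel) \<longlongrightarrow> 0) at_top"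
proof -
  let ?f = "\<lambda>N::real. \<lambda>x. indicator {-N..N} x *\<^sub>R f x"
  let ?t = "\<lambda>N::real. \<lambda>x. indicator (- {-N..N}) x * (cmod (f x))\<^sup>2"
  let ?C = "(cmod c)\<^sup>2 * (2 * pi / \<bar>\<alpha>\<bar>)"
  define G where "G N y = (LINT x|lborel. chirp c a \<alpha> x y * ?f N x)" for N y
  define \<tau> where "\<tau> N = ennreal ?C * ennreal (LINT x|lborel. ?t N x)" for N
  have fm [measurable]: "f \<in> borel_measurable borel" and f2: "integrable lborel (\<lambda>x. (cmod (f x))\<^sup>2)"
    using f by (auto simp: square_integrable_def)
  have t_int: "integrable lborel (?t N)" for N
    using integrable_mult_indicator[OF _ f2, of "- {-N..N}"] by simp
  have [measurable]: "G N \<in> borel_measurable lborel" for N unfolding G_def by measurable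
  have bd: "(\<integral>\<^sup>+y. ennreal ((cmod (G M y - G N y))\<^sup>2) \<partial>lborel) \<le> \<tau> N" if "0 \<le> N" "N \<le> M" for M N
  proof -
    have "G M y - G N y = (LINT x|lborel. chirp c a \<alpha> x y * (?f M x - ?f N x))" for y
      unfolding G_def right_diff_distrib
      by (intro Bochner_Integration.integral_diff[symmetric] integrable_chirp_mult integrable_truncation f)
    moreover have "integrable lborel (\<lambda>x. ?f M x - ?f N x)"
      by (intro Bochner_Integration.integrable_diff integrable_truncation f)
    ultimately have "(\<integral>\<^sup>+y. ennreal ((cmod (G M y - G N y))\<^sup>2) \<partial>lborel)
        \<le> ennreal ?C * (\<integral>\<^sup>+x. ennreal ((cmod (?f M x - ?f N x))\<^sup>2) \<partial>lborel)"
      using chirp_L2_bound[of "\<lambda>x. ?f M x - ?f N x", OF _ \<alpha>] by simp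
    also have "\<dots> \<le> ennreal ?C * (\<integral>\<^sup>+x. ennreal (?t N x) \<partial>lborel)"
      using that by (intro mult_left_mono nn_integral_mono ennreal_leI) (auto simp: indicator_def)
    also have "\<dots> = \<tau> N"
      using t_int[of N] unfolding \<tau>_def by (subst nn_integral_eq_integral) auto
    finally show ?thesis .
  qed
  have "((\<lambda>N. LINT x|lborel. ?t N x) \<longlongrightarrow> (LINT x::real|lborel. 0)) at_top"
  proof (rule integral_dominated_convergence_at_top[where w = "\<lambda>x. (cmod (f x))\<^sup>2"])
    show "AE x in lborel. ((\<lambda>N. ?t N x) \<longlongrightarrow> 0) at_top"
    proof (rule AE_I2)
      fix x :: real
      have "\<forall>\<^sub>F N in at_top. ?t N x = 0"
        using eventually_ge_at_top[of "\<bar>x\<bar>"] by eventually_elim (auto simp: indicator_def)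
      then show "((\<lambda>N. ?t N x) \<longlongrightarrow> 0) at_top" by (rule tendsto_eventually)
    qed
  qed (use f2 in \<open>auto simp: indicator_def\<close>)
  then have "((\<lambda>N. ennreal (?C * (LINT x|lborel. ?t N x))) \<longlongrightarrow> ennreal (?C * 0)) at_top"
    by (intro tendsto_ennrealI tendsto_mult tendsto_const) simp
  moreover have "\<tau> = (\<lambda>N. ennreal (?C * (LINT x|lborel. ?t N x)))"
    unfolding \<tau>_def by (intro ext ennreal_mult[symmetric]) simp_all
  ultimately have \<tau>: "(\<tau> \<longlongrightarrow> 0) at_top" by simp
  obtain g where [measurable]: "g \<in> borel_measurable lborel"
    and g: "\<And>N. 0 \<le> N \<Longrightarrow> (\<integral>\<^sup>+y. ennreal ((cmod (g y - G N y))\<^sup>2) \<partial>lborel) \<le> \<tau> N"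
    using L2_limit_exists[of G \<tau>, OF _ bd \<tau>] by auto
  \<comment> \<open>At \<open>N = 0\<close> the truncation is supported on a single point. The bound
    there thus estimates \<open>g\<close> itself and shows it square integrable.\<close>
  have "G 0 y = 0" for y
  proof -
    have "AE x in lborel. x \<noteq> (0::real)" by (rule AE_lborel_singleton)
    then have "AE x in lborel. chirp c a \<alpha> x y * ?f 0 x = 0" by eventually_elim simp
    then show ?thesis unfolding G_def by (rule integral_eq_zero_AE)
  qed
  then have "(\<integral>\<^sup>+y. ennreal ((cmod (g y))\<^sup>2) \<partial>lborel) \<le> \<tau> 0" using g[of 0] by simp
  also have "\<dots> < \<infinity>" unfolding \<tau>_def by (simp add: ennreal_mult_less_top)
  finally have "square_integrable g"
    unfolding square_integrable_def integrable_iff_bounded by simp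
  moreover have "((\<lambda>N. \<integral>\<^sup>+y. ennreal ((cmod (g y - G N y))\<^sup>2) \<partial>lborel) \<longlongrightarrow> 0) at_top"
    using \<tau>
  proof (rule tendsto_sandwich[rotated 3])
    show "\<forall>\<^sub>F N in at_top. (\<integral>\<^sup>+y. ennreal ((cmod (g y - G N y))\<^sup>2) \<partial>lborel) \<le> \<tau> N"
      using eventually_ge_at_top[of 0] by eventually_elim (rule g)
  qed auto
  ultimately show ?thesis using that unfolding G_def truncated_chirp_integral by blast
qed

section \<open>Pairing with Gaussians\<close>

lemma square_integrable_mult_integrable:
  assumes "square_integrable f" "square_integrable g"
  shows "integrable lborel (\<lambda>x. f x * g x)"
proof (rule Bochner_Integration.integrable_bound)
  show "integrable lborel (\<lambda>x. (cmod (f x))\<^sup>2 + (cmod (g x))\<^sup>2)"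
    using assms by (simp add: square_integrable_def)
  show "AE x in lborel. norm (f x * g x) \<le> norm ((cmod (f x))\<^sup>2 + (cmod (g x))\<^sup>2)"
  proof (rule AE_I2)
    fix x
    have "0 \<le> cmod (f x) * cmod (g x)" by simp
    then show "norm (f x * g x) \<le> norm ((cmod (f x))\<^sup>2 + (cmod (g x))\<^sup>2)"
      using sum_squares_bound[of "cmod (f x)" "cmod (g x)"] unfolding norm_mult real_norm_def by linarith
  qed
qed (use assms in \<open>auto simp: square_integrable_def\<close>)

lemma square_integrable_diff:
  assumes "square_integrable f" "square_integrable g"
  shows "square_integrable (\<lambda>x. f x - g x)"
  unfolding square_integrable_def
proof
  show "integrable lborel (\<lambda>x. (cmod (f x - g x))\<^sup>2)"
  proof (rule Bochner_Integration.integrable_bound)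
    show "integrable lborel (\<lambda>x. 2 * (cmod (f x))\<^sup>2 + 2 * (cmod (g x))\<^sup>2)"
      using assms by (simp add: square_integrable_def)
    have "(cmod (f x - g x))\<^sup>2 \<le> 2 * (cmod (f x))\<^sup>2 + 2 * (cmod (g x))\<^sup>2" for x
    proof -
      have "(cmod (f x - g x))\<^sup>2 \<le> (cmod (f x) + cmod (g x))\<^sup>2"
        by (intro power_mono norm_triangle_ineq4) simp
      also have "\<dots> \<le> 2 * (cmod (f x))\<^sup>2 + 2 * (cmod (g x))\<^sup>2"
        using sum_squares_bound[of "cmod (f x)" "cmod (g x)"] unfolding power2_sum by linarith
      finally show ?thesis .
    qed
    then show "AE x in lborel. norm ((cmod (f x - g x))\<^sup>2) \<le> norm (2 * (cmod (f x))\<^sup>2 + 2 * (cmod (g x))\<^sup>2)"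
      by simp
  qed (use assms in \<open>auto simp: square_integrable_def\<close>)
qed (use assms in \<open>auto simp: square_integrable_def\<close>)

lemma square_integrable_gauss:
  assumes "Re z > 0"
  shows "square_integrable (gauss z w)"
proof -
  have "2 * Re z > 0" using assms by simp
  from integrable.intros[OF real_gaussian_integral[OF this, of "2 * Re w"]]
  have "integrable lborel (\<lambda>x. (cmod (gauss z w x))\<^sup>2)"
    by (simp add: cmod_gauss exp_double[symmetric] algebra_simps)
  then show ?thesis by (simp add: square_integrable_def)
qed

text \<open>Cauchy-Schwarz for the extended integral: the squared error is at most the L2 mass of
  \<open>\<gamma>\<close> times the squared L2 distance, and only the products
  \<open>G N x * \<gamma> x\<close> have to be integrable.\<close>

lemma tendsto_integral_mult_of_L2_limit:
  assumes g: "square_integrable g" and \<gamma>: "square_integrable \<gamma>"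
    and [measurable]: "\<And>N. G N \<in> borel_measurable lborel"
    and G: "\<And>N. integrable lborel (\<lambda>x. G N x * \<gamma> x)"
    and lim: "((\<lambda>N. \<integral>\<^sup>+x. ennreal ((cmod (g x - G N x))\<^sup>2) \<partial>lborel) \<longlongrightarrow> 0) F"
  shows "((\<lambda>N. LINT x|lborel. G N x * \<gamma> x) \<longlongrightarrow> (LINT x|lborel. g x * \<gamma> x)) F"
proof -
  have [measurable]: "g \<in> borel_measurable borel" "\<gamma> \<in> borel_measurable borel"
    using g \<gamma> by (auto simp: square_integrable_def)
  let ?I = "\<lambda>N. LINT x|lborel. G N x * \<gamma> x" and ?J = "LINT x|lborel. g x * \<gamma> x"
  let ?a = "\<lambda>N. \<integral>\<^sup>+x. ennreal ((cmod (g x - G N x))\<^sup>2) \<partial>lborel"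
  let ?b = "\<integral>\<^sup>+x. ennreal ((cmod (\<gamma> x))\<^sup>2) \<partial>lborel"
  have b: "?b < top"
    using \<gamma> unfolding square_integrable_def integrable_iff_bounded by simp
  have "ennreal ((cmod (?I N - ?J))\<^sup>2) \<le> ?b * ?a N" for N
  proof -
    have "?J - ?I N = (LINT x|lborel. (g x - G N x) * \<gamma> x)"
      unfolding left_diff_distrib
      using square_integrable_mult_integrable[OF g \<gamma>] G by simp
    then have "ennreal (cmod (?J - ?I N)) \<le> (\<integral>\<^sup>+x. ennreal (cmod (g x - G N x)) * ennreal (cmod (\<gamma> x)) \<partial>lborel)"
      using norm_integral_le_nn_integral[of lborel "\<lambda>x. (g x - G N x) * \<gamma> x"] by (simp add: norm_mult ennreal_mult)
    then have "(ennreal (cmod (?J - ?I N)))\<^sup>2 \<le> (\<integral>\<^sup>+x. ennreal (cmod (g x - G N x)) * ennreal (cmod (\<gamma> x)) \<partial>lborel)\<^sup>2"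
      by (rule power_mono) simp
    also have "\<dots> \<le> (\<integral>\<^sup>+x. (ennreal (cmod (g x - G N x)))\<^sup>2 \<partial>lborel) * (\<integral>\<^sup>+x. (ennreal (cmod (\<gamma> x)))\<^sup>2 \<partial>lborel)"
      by (rule Cauchy_Schwarz_nn_integral) measurable
    finally show ?thesis
      by (simp add: ennreal_power mult.commute norm_minus_commute)
  qed
  note le = this
  have "((\<lambda>N. ?b * ?a N) \<longlongrightarrow> ?b * 0) F"
    using b lim by (rule ennreal_tendsto_cmult)
  then have ba: "((\<lambda>N. ?b * ?a N) \<longlongrightarrow> 0) F" by simp
  have "((\<lambda>N. ennreal ((cmod (?I N - ?J))\<^sup>2)) \<longlongrightarrow> ennreal 0) F"
    unfolding ennreal_0
    by (rule tendsto_sandwich[OF _ always_eventually[OF allI[OF le]] tendsto_const ba]) simp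
  from tendsto_enn2real[OF this]
  have "((\<lambda>N. (cmod (?I N - ?J))\<^sup>2) \<longlongrightarrow> 0) F" by simp
  then have "((\<lambda>N. sqrt ((cmod (?I N - ?J))\<^sup>2)) \<longlongrightarrow> sqrt 0) F"
    by (rule tendsto_real_sqrt)
  then have "((\<lambda>N. cmod (?I N - ?J)) \<longlongrightarrow> 0) F" by simp
  then show ?thesis by (rule LIM_zero_cancel[OF tendsto_norm_zero_cancel])
qed

text \<open>The chirp shifts \<open>z\<close> by \<open>- \<i> * of_real a\<close> and
  \<open>w\<close> by \<open>\<i> * of_real (\<alpha> * x)\<close>. The Gaussian formula then has an
  exponent quadratic in \<open>x\<close>, so the image is again a Gaussian.\<close>

lemma chirp_gauss:
  assumes "Re z > 0"
  shows "(LINT y|lborel. chirp c a \<alpha> x y * gauss z w y)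
    = c * csqrt (of_real pi / (z - \<i> * of_real a)) * exp (w\<^sup>2 / (4 * (z - \<i> * of_real a))) *
      gauss ((of_real \<alpha>)\<^sup>2 / (4 * (z - \<i> * of_real a)) - \<i> * of_real a) (\<i> * of_real \<alpha> * w / (2 * (z - \<i> * of_real a))) x"
proof -
  let ?\<zeta> = "z - \<i> * of_real a"
  have \<zeta>: "Re ?\<zeta> > 0" "?\<zeta> \<noteq> 0" using assms by auto
  have "chirp c a \<alpha> x y * gauss z w y = c * exp (\<i> * of_real (a * x\<^sup>2)) * gauss ?\<zeta> (w + \<i> * of_real (\<alpha> * x)) y" for y
    unfolding chirp_def gauss_def mult.assoc exp_add[symmetric]
    by (intro arg_cong[where f = "(*) c"] arg_cong[where f = exp]) (simp add: algebra_simps)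
  then have "(LINT y|lborel. chirp c a \<alpha> x y * gauss z w y)
     = c * csqrt (of_real pi / ?\<zeta>) * (exp (\<i> * of_real (a * x\<^sup>2)) * exp ((w + \<i> * of_real (\<alpha> * x))\<^sup>2 / (4 * ?\<zeta>)))"
    using gaussian_integral[OF \<zeta>(1)] by (simp add: mult_ac)
  also have "exp (\<i> * of_real (a * x\<^sup>2)) * exp ((w + \<i> * of_real (\<alpha> * x))\<^sup>2 / (4 * ?\<zeta>))
     = exp (w\<^sup>2 / (4 * ?\<zeta>)) * gauss ((of_real \<alpha>)\<^sup>2 / (4 * ?\<zeta>) - \<i> * of_real a) (\<i> * of_real \<alpha> * w / (2 * ?\<zeta>)) x"
  proof -
    have "(w + \<i> * of_real (\<alpha> * x))\<^sup>2 = w\<^sup>2 + 2 * \<i> * of_real \<alpha> * w * of_real x - (of_real \<alpha>)\<^sup>2 * (of_real x)\<^sup>2"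
      by (simp add: power2_eq_square algebra_simps)
    then have "(w + \<i> * of_real (\<alpha> * x))\<^sup>2 / (4 * ?\<zeta>) = w\<^sup>2 / (4 * ?\<zeta>) + 2 * \<i> * of_real \<alpha> * w * of_real x / (4 * ?\<zeta>)
       - (of_real \<alpha>)\<^sup>2 * (of_real x)\<^sup>2 / (4 * ?\<zeta>)"
      by (simp only: add_divide_distrib diff_divide_distrib)
    also have "2 * \<i> * of_real \<alpha> * w * of_real x / (4 * ?\<zeta>) = \<i> * of_real \<alpha> * w / (2 * ?\<zeta>) * of_real x"
      unfolding times_divide_eq_left using \<zeta>(2) by (subst frac_eq_eq) (simp_all add: mult_ac)
    finally show ?thesis
      unfolding gauss_def exp_add[symmetric]
      by (intro arg_cong[where f = exp]) (simp add: algebra_simps)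
  qed
  finally show ?thesis by (simp add: mult.assoc)
qed

text \<open>For truncated \<open>f\<close> the identity is Fubini's theorem. As \<open>N\<close>
  grows, one side converges by dominated convergence and the other by continuity of the pairing in
  L2.\<close>

lemma chirp_pairing:
  assumes f: "square_integrable f" and g: "square_integrable g" and \<alpha>: "\<alpha> \<noteq> 0" and z: "Re z > 0"
    and lim: "((\<lambda>N::real. \<integral>\<^sup>+y. ennreal ((cmod (g y - (LINT x:{-N..N}|lborel. chirp c a \<alpha> x y * f x)))\<^sup>2) \<partial>lborel) \<longlongrightarrow> 0) at_top"
  shows "(LINT y|lborel. g y * gauss z w y) = (LINT x|lborel. f x * (LINT y|lborel. chirp c a \<alpha> x y * gauss z w y))"
proof -
  let ?f = "\<lambda>N::real. \<lambda>x. indicator {-N..N} x *\<^sub>R f x"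
  let ?K = "\<lambda>x. LINT y|lborel. chirp c a \<alpha> x y * gauss z w y"
  let ?\<zeta> = "z - \<i> * of_real a"
  define G where "G N y = (LINT x|lborel. chirp c a \<alpha> x y * ?f N x)" for N y
  have fm [measurable]: "f \<in> borel_measurable borel"
    using f by (auto simp: square_integrable_def)
  have Gm [measurable]: "G N \<in> borel_measurable lborel" for N unfolding G_def by measurable
  \<comment> \<open>The image of the Gaussian is again square integrable, so its product with
    \<open>f\<close> can serve as the dominating function.\<close>
  have "Re ((of_real \<alpha>)\<^sup>2 / (4 * ?\<zeta>) - \<i> * of_real a) > 0"
    using Re_divide_pos[of "4 * ?\<zeta>" "\<alpha>\<^sup>2"] z \<alpha> by simp
  from square_integrable_mult_integrable[OF f square_integrable_gauss[OF this]]
  have fK: "integrable lborel (\<lambda>x. f x * ?K x)"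
    unfolding chirp_gauss[OF z] mult.left_commute[of "f _"] by simp
  have "((\<lambda>N. LINT x|lborel. ?f N x * ?K x) \<longlongrightarrow> (LINT x|lborel. f x * ?K x)) at_top"
  proof (rule integral_dominated_convergence_at_top[where w = "\<lambda>x. cmod (f x * ?K x)"])
    show "AE x in lborel. ((\<lambda>N. ?f N x * ?K x) \<longlongrightarrow> f x * ?K x) at_top"
    proof (rule AE_I2)
      fix x :: real
      have "\<forall>\<^sub>F N in at_top. ?f N x * ?K x = f x * ?K x"
        using eventually_ge_at_top[of "\<bar>x\<bar>"] by eventually_elim (auto simp: indicator_def)
      then show "((\<lambda>N. ?f N x * ?K x) \<longlongrightarrow> f x * ?K x) at_top" by (rule tendsto_eventually)
    qed
    show "integrable lborel (\<lambda>x. cmod (f x * ?K x))" using fK by (rule integrable_norm)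
    show "\<forall>\<^sub>F N in at_top. AE x in lborel. norm (?f N x * ?K x) \<le> cmod (f x * ?K x)"
      by (auto simp: indicator_def)
  qed measurable
  moreover have "(LINT x|lborel. ?f N x * ?K x) = (LINT y|lborel. G N y * gauss z w y)" for N
    using Fubini_bounded_kernel[of "chirp c a \<alpha>" "cmod c" "?f N" "gauss z w"]
      integrable_truncation[OF f] integrable_gauss[OF z] unfolding G_def by (simp add: mult.commute[of "gauss z w _"])
  moreover have "((\<lambda>N. LINT y|lborel. G N y * gauss z w y) \<longlongrightarrow> (LINT y|lborel. g y * gauss z w y)) at_top"
  proof (rule tendsto_integral_mult_of_L2_limit[OF g square_integrable_gauss[OF z] Gm])
    show "((\<lambda>N. \<integral>\<^sup>+y. ennreal ((cmod (g y - G N y))\<^sup>2) \<partial>lborel) \<longlongrightarrow> 0) at_top"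
      using lim unfolding truncated_chirp_integral G_def .
    show "integrable lborel (\<lambda>y. G N y * gauss z w y)" for N
    proof (rule Bochner_Integration.integrable_bound)
      show "integrable lborel (\<lambda>y. (LINT x|lborel. cmod c * cmod (?f N x)) * cmod (gauss z w y))"
        using integrable_gauss[OF z] by simp
      have "cmod (G N y) \<le> (LINT x|lborel. cmod c * cmod (?f N x))" for y
        using integral_norm_bound[of lborel "\<lambda>x. chirp c a \<alpha> x y * ?f N x"]
        unfolding G_def norm_mult cmod_chirp .
      then show "AE y in lborel. norm (G N y * gauss z w y) \<le> norm ((LINT x|lborel. cmod c * cmod (?f N x)) * cmod (gauss z w y))"
        unfolding norm_mult by (intro AE_I2 mult_mono) (auto intro: order_trans[OF _ abs_ge_self])
    qed measurable
  qed
  ultimately show ?thesis using tendsto_unique[OF trivial_limit_at_top_linorder] by auto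
qed

text \<open>Positive and negative part, normalised, are probability densities with equal characteristic
  functions.\<close>

lemma real_fourier_zero_imp_AE_zero:
  fixes v :: "real \<Rightarrow> real"
  assumes v: "integrable lborel v"
    and zero: "\<And>k::real. (LINT x|lborel. of_real (v x) * iexp (k * x)) = 0"
  shows "AE x in lborel. v x = 0"
proof -
  define p n where "p x = max 0 (v x)" and "n x = max 0 (- v x)" for x
  have [measurable]: "v \<in> borel_measurable borel" using v by (auto dest: borel_measurable_integrable)
  have p: "integrable lborel p" "\<And>x. p x \<ge> 0" and n: "integrable lborel n" "\<And>x. n x \<ge> 0"
    using v by (auto simp: p_def[abs_def] n_def[abs_def])
  have [measurable]: "p \<in> borel_measurable borel" "n \<in> borel_measurable borel"
    using p(1) n(1) by (auto dest: borel_measurable_integrable)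
  have v_eq: "v x = p x - n x" for x by (simp add: p_def n_def)
  have int: "integrable lborel (\<lambda>x. of_real (g x) * iexp (k * x))" if "integrable lborel g" for g :: "real \<Rightarrow> real" and k
    by (rule Bochner_Integration.integrable_bound[OF that])
       (use borel_measurable_integrable[OF that] in \<open>auto simp: norm_mult\<close>)
  have eq: "(LINT x|lborel. of_real (p x) * iexp (k * x)) = (LINT x|lborel. of_real (n x) * iexp (k * x))" for k
    using zero[of k] unfolding v_eq of_real_diff left_diff_distrib
    by (subst (asm) Bochner_Integration.integral_diff) (use int p n in auto)
  \<comment> \<open>Frequency 0 shows that both parts have the same mass, so one constant
    \<open>m\<close> normalises both.\<close>
  have mass: "(LINT x|lborel. p x) = (LINT x|lborel. n x)"
    using eq[of 0] by (simp del: of_real_eq_iff) (simp only: integral_complex_of_real of_real_eq_iff)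
  define m where "m = (LINT x|lborel. p x)"
  have m0: "m \<ge> 0" unfolding m_def using p(2) by simp
  show ?thesis
  proof (cases "m = 0")
    case True
    then have "AE x in lborel. p x = 0" "AE x in lborel. n x = 0"
      using integral_nonneg_eq_0_iff_AE[OF p(1)] integral_nonneg_eq_0_iff_AE[OF n(1)] p(2) n(2) mass
      unfolding m_def by simp_all
    then show ?thesis by eventually_elim (simp add: v_eq)
  next
    case False
    with m0 have m: "m > 0" by simp
    have dist: "real_distribution (density lborel (\<lambda>x. ennreal (g x / m)))"
      and char: "char (density lborel (\<lambda>x. ennreal (g x / m))) k = (LINT x|lborel. of_real (g x) * iexp (k * x)) / of_real m"
      if g: "integrable lborel g" "\<And>x. g x \<ge> 0" "(LINT x|lborel. g x) = m" for g :: "real \<Rightarrow> real" and k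
    proof -
      have [measurable]: "g \<in> borel_measurable borel" using g(1) by (auto dest: borel_measurable_integrable)
      have "emeasure (density lborel (\<lambda>x. ennreal (g x / m))) UNIV = (\<integral>\<^sup>+x. ennreal (g x / m) \<partial>lborel)"
        by (simp add: emeasure_density)
      also have "\<dots> = ennreal (LINT x|lborel. g x / m)"
        using g m by (intro nn_integral_eq_integral) auto
      also have "\<dots> = 1" using g(3) m by simp
      finally have "prob_space (density lborel (\<lambda>x. ennreal (g x / m)))"
        by (intro prob_spaceI) simp
      then show "real_distribution (density lborel (\<lambda>x. ennreal (g x / m)))"
        by (simp add: real_distribution_def real_distribution_axioms_def)
      have "char (density lborel (\<lambda>x. ennreal (g x / m))) k = (LINT x|lborel. (g x / m) *\<^sub>R iexp (k * x))"
        unfolding char_def using g m by (subst integral_density) auto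
      also have "\<dots> = (LINT x|lborel. of_real (g x) * iexp (k * x) / of_real m)"
        by (rule Bochner_Integration.integral_cong) (simp_all add: scaleR_conv_of_real)
      finally show "char (density lborel (\<lambda>x. ennreal (g x / m))) k = (LINT x|lborel. of_real (g x) * iexp (k * x)) / of_real m"
        by simp
    qed
    have "density lborel (\<lambda>x. ennreal (p x / m)) = density lborel (\<lambda>x. ennreal (n x / m))"
    proof (rule Levy_uniqueness)
      show "char (density lborel (\<lambda>x. ennreal (p x / m))) = char (density lborel (\<lambda>x. ennreal (n x / m)))"
        using char[OF p] char[OF n] mass eq by (auto simp: m_def)
    qed (use dist[OF p] dist[OF n] mass in \<open>auto simp: m_def\<close>)
    then have "AE x in lborel. ennreal (p x / m) = ennreal (n x / m)"
      by (subst (asm) sigma_finite_measure.density_unique_iff[OF sigma_finite_lborel]) auto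
    then show ?thesis
    proof eventually_elim
      case (elim x)
      then have "p x / m = n x / m"
        using p(2) n(2) m by (subst (asm) ennreal_inj) auto
      then show ?case using m by (simp add: v_eq)
    qed
  qed
qed

text \<open>The transform of \<open>cnj (u x)\<close> at \<open>k\<close> is the conjugate of that
  of \<open>u\<close> at \<open>- k\<close>. Hence it vanishes too, and so do the transforms of the
  real and imaginary parts.\<close>

lemma fourier_zero_imp_AE_zero:
  fixes u :: "real \<Rightarrow> complex"
  assumes u: "integrable lborel u"
    and zero: "\<And>k::real. (LINT x|lborel. u x * iexp (k * x)) = 0"
  shows "AE x in lborel. u x = 0"
proof -
  have int: "integrable lborel (\<lambda>x. g x * iexp (k * x))" if "integrable lborel g" for g :: "real \<Rightarrow> complex" and k
    by (rule Bochner_Integration.integrable_bound[OF that])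
       (use borel_measurable_integrable[OF that] in \<open>auto simp: norm_mult\<close>)
  have u': "integrable lborel (\<lambda>x. cnj (u x))" using u by simp
  have zero': "(LINT x|lborel. cnj (u x) * iexp (k * x)) = 0" for k
  proof -
    have "(LINT x|lborel. cnj (u x) * iexp (k * x)) = (LINT x|lborel. cnj (u x * iexp (- k * x)))"
      by (intro Bochner_Integration.integral_cong) (simp_all add: exp_cnj)
    then show ?thesis by (simp only: Bochner_Integration.integral_cnj zero complex_cnj_zero)
  qed
  have "(LINT x|lborel. of_real (Re (u x)) * iexp (k * x)) = 0" for k
  proof -
    have eq: "of_real (Re (u x)) * iexp (k * x) = (u x * iexp (k * x) + cnj (u x) * iexp (k * x)) / 2" for x
      by (simp add: distrib_right[symmetric] complex_add_cnj)
    show ?thesis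
      unfolding eq integral_divide_zero Bochner_Integration.integral_add[OF int[OF u] int[OF u']] zero zero' by simp
  qed
  moreover have "(LINT x|lborel. of_real (Im (u x)) * iexp (k * x)) = 0" for k
  proof -
    have "of_real (Im (u x)) = - \<i> / 2 * (u x - cnj (u x))" for x by (simp add: complex_eq_iff)
    then have eq: "of_real (Im (u x)) * iexp (k * x) = - \<i> / 2 * (u x * iexp (k * x) - cnj (u x) * iexp (k * x))" for x
      by (simp only: left_diff_distrib mult.assoc)
    show ?thesis
      unfolding eq integral_mult_right_zero Bochner_Integration.integral_diff[OF int[OF u] int[OF u']] zero zero' by simp
  qed
  ultimately have "AE x in lborel. Re (u x) = 0" "AE x in lborel. Im (u x) = 0"
    using real_fourier_zero_imp_AE_zero u by simp_all
  then show ?thesis by eventually_elim (simp add: complex_eq_iff)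
qed

text \<open>Multiplication by exp(-x^2) makes \<open>h\<close> integrable without creating zeros,
  and turns the pairings into Fourier coefficients.\<close>

lemma gauss_pairing_zero_imp_AE_zero:
  assumes h: "square_integrable h"
    and zero: "\<And>k::real. (LINT x|lborel. h x * gauss 1 (\<i> * of_real k) x) = 0"
  shows "AE x in lborel. h x = 0"
proof -
  have eq: "h x * gauss 1 0 x * iexp (k * x) = h x * gauss 1 (\<i> * of_real k) x" for x k
    by (simp add: gauss_def mult_exp_exp algebra_simps)
  have "AE x in lborel. h x * gauss 1 0 x = 0"
  proof (rule fourier_zero_imp_AE_zero)
    show "integrable lborel (\<lambda>x. h x * gauss 1 0 x)"
      by (intro square_integrable_mult_integrable h square_integrable_gauss) simp
  qed (simp only: eq zero)
  then show ?thesis by eventually_elim (simp add: gauss_def)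
qed

section \<open>Gaussian pairings of elements of L2\<close>

text \<open>Bilinear, without complex conjugation, so that a kernel crosses it unconjugated.\<close>

definition pairing :: "L2 \<Rightarrow> complex \<Rightarrow> complex \<Rightarrow> complex" where
  "pairing \<psi> z w = (LINT x|lborel. rep_L2 \<psi> x * gauss z w x)"

lemma square_integrable_rep_L2: "square_integrable (rep_L2 \<psi>)"
  using Quotient3_rep_reflp[OF Quotient3_L2, of \<psi>] by (simp add: L2_rel_def)

lemma rep_abs_L2_AE:
  assumes "square_integrable f"
  shows "AE x in lborel. rep_L2 (abs_L2 f) x = f x"
  using Quotient3_rep_abs[OF Quotient3_L2, of f] assms by (simp add: L2_rel_def)

lemma L2_eqI:
  assumes "\<And>z w. Re z > 0 \<Longrightarrow> pairing \<phi> z w = pairing \<psi> z w"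
  shows "\<phi> = \<psi>"
proof -
  have "AE x in lborel. rep_L2 \<phi> x - rep_L2 \<psi> x = 0"
  proof (rule gauss_pairing_zero_imp_AE_zero)
    fix k :: real
    have i: "integrable lborel (\<lambda>x. rep_L2 \<eta> x * gauss 1 (\<i> * of_real k) x)" for \<eta>
      by (intro square_integrable_mult_integrable square_integrable_rep_L2 square_integrable_gauss) simp
    show "(LINT x|lborel. (rep_L2 \<phi> x - rep_L2 \<psi> x) * gauss 1 (\<i> * of_real k) x) = 0"
      using assms[of 1 "\<i> * of_real k"] unfolding left_diff_distrib pairing_def
      by (subst Bochner_Integration.integral_diff[OF i i]) simp
  qed (intro square_integrable_diff square_integrable_rep_L2)
  then have "L2_rel (rep_L2 \<phi>) (rep_L2 \<psi>)"
    by (simp add: L2_rel_def square_integrable_rep_L2)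
  then show ?thesis using Quotient3_rel_rep[OF Quotient3_L2] by blast
qed

text \<open>This also justifies the definite description in \<open>kernel_op\<close>: a limit exists
  by \<open>chirp_truncated_limit\<close>, and it is unique because the pairings of any limit are
  determined by \<psi>.\<close>

lemma pairing_kernel_op_chirp:
  assumes \<alpha>: "\<alpha> \<noteq> 0" and z: "Re z > 0"
  shows "pairing (kernel_op (chirp c a \<alpha>) \<psi>) z w
    = c * csqrt (of_real pi / (z - \<i> * of_real a)) * exp (w\<^sup>2 / (4 * (z - \<i> * of_real a))) *
      pairing \<psi> ((of_real \<alpha>)\<^sup>2 / (4 * (z - \<i> * of_real a)) - \<i> * of_real a) (\<i> * of_real \<alpha> * w / (2 * (z - \<i> * of_real a)))"
proof -
  let ?P = "\<lambda>\<phi>. ((\<lambda>N::real. \<integral>\<^sup>+y. ennreal ((cmod (rep_L2 \<phi> y - (LINT x:{-N..N}|lborel. chirp c a \<alpha> x y * rep_L2 \<psi> x)))\<^sup>2) \<partial>lborel) \<longlongrightarrow> 0) at_top"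
  have pair: "pairing \<phi> z w = (LINT x|lborel. rep_L2 \<psi> x * (LINT y|lborel. chirp c a \<alpha> x y * gauss z w y))"
    if "?P \<phi>" "Re z > 0" for \<phi> z w
    unfolding pairing_def using chirp_pairing[OF square_integrable_rep_L2 square_integrable_rep_L2 \<alpha> that(2,1)] .
  obtain g where g: "square_integrable g"
    "((\<lambda>N::real. \<integral>\<^sup>+y. ennreal ((cmod (g y - (LINT x:{-N..N}|lborel. chirp c a \<alpha> x y * rep_L2 \<psi> x)))\<^sup>2) \<partial>lborel) \<longlongrightarrow> 0) at_top"
    by (rule chirp_truncated_limit[OF square_integrable_rep_L2 \<alpha>])
  have "(\<integral>\<^sup>+y. ennreal ((cmod (rep_L2 (abs_L2 g) y - F y))\<^sup>2) \<partial>lborel) = (\<integral>\<^sup>+y. ennreal ((cmod (g y - F y))\<^sup>2) \<partial>lborel)" for F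
    by (rule nn_integral_cong_AE) (use rep_abs_L2_AE[OF g(1)] in eventually_elim, simp)
  with g(2) have "?P (abs_L2 g)" by simp
  then have "?P (kernel_op (chirp c a \<alpha>) \<psi>)"
    unfolding kernel_op_def
    by (rule theI) (rule L2_eqI, simp only: pair \<open>?P (abs_L2 g)\<close>)
  from pair[OF this z] show ?thesis
    unfolding chirp_gauss[OF z] mult.left_commute[of "rep_L2 \<psi> _"] pairing_def[of \<psi>] by simp
qed

section \<open>Composition of chirp operators\<close>

text \<open>The parameter map preserves the right half plane, so the pairing formula can be
  iterated.\<close>

lemma Re_chirp_image_pos:
  assumes "Re z > 0" "\<alpha> \<noteq> 0"
  shows "Re ((of_real \<alpha>)\<^sup>2 / (4 * (z - \<i> * of_real a)) - \<i> * of_real a) > 0"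
  using Re_divide_pos[of "4 * (z - \<i> * of_real a)" "\<alpha>\<^sup>2"] assms by simp

text \<open>\<open>D\<close> is the product of the two Gaussian widths met on the way.  It does not depend on the order of
  the two operators if \<open>\<alpha>\<^sup>2 - 4 a\<^sup>2 = \<beta>\<^sup>2 - 4 b\<^sup>2\<close>.\<close>

lemma pairing_kernel_op_chirp_comp:
  fixes a b \<alpha> \<beta> :: real and c c' z w :: complex
  assumes \<alpha>: "\<alpha> \<noteq> 0" and \<beta>: "\<beta> \<noteq> 0" and z: "Re z > 0"
  defines "z1 \<equiv> z - \<i> * of_real a"
  defines "D \<equiv> (of_real \<alpha>)\<^sup>2 / 4 - \<i> * (of_real a + of_real b) * z1"
  shows "pairing (kernel_op (chirp c a \<alpha>) (kernel_op (chirp c' b \<beta>) \<psi>)) z w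
    = c * c' * (csqrt (of_real pi / z1) * csqrt (of_real pi * z1 / D)) * exp (- \<i> * (of_real a + of_real b) * w\<^sup>2 / (4 * D)) *
      pairing \<psi> ((of_real \<beta>)\<^sup>2 * z1 / (4 * D) - \<i> * of_real b) (- (of_real \<alpha> * of_real \<beta> * w / (4 * D)))"
    and "Re (of_real pi / z1) > 0" and "Re (of_real pi * z1 / D) > 0" and "D \<noteq> 0"
proof -
  define z' where "z' = (of_real \<alpha>)\<^sup>2 / (4 * z1) - \<i> * of_real a"
  define w' where "w' = \<i> * of_real \<alpha> * w / (2 * z1)"
  define z2 where "z2 = z' - \<i> * of_real b"
  have nz: "x \<noteq> 0" if "Re x > 0" for x using that by auto
  have "Re z1 > 0" using z by (simp add: z1_def)
  note z1 = this nz[OF this]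
  have z': "Re z' > 0" unfolding z1_def z'_def by (rule Re_chirp_image_pos[OF z \<alpha>])
  then have "Re z2 > 0" by (simp add: z2_def)
  note z2 = this nz[OF this]
  have D: "z2 = D / z1" using z1(2) by (simp add: D_def z2_def z'_def field_simps)
  with z2(2) show D0: "D \<noteq> 0" by auto
  have e: "of_real pi / z2 = of_real pi * z1 / D" unfolding D by simp
  show "Re (of_real pi / z1) > 0" by (rule Re_divide_pos) (use z1 in auto)
  show "Re (of_real pi * z1 / D) > 0"
    unfolding e[symmetric] by (rule Re_divide_pos[OF z2(1)]) simp
  \<comment> \<open>The Gaussian meets the outer operator first, since moving operators across the
    pairing reverses their order.\<close>
  have "pairing (kernel_op (chirp c a \<alpha>) (kernel_op (chirp c' b \<beta>) \<psi>)) z w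
    = c * csqrt (of_real pi / z1) * exp (w\<^sup>2 / (4 * z1)) *
      pairing (kernel_op (chirp c' b \<beta>) \<psi>) z' w'"
    unfolding z'_def w'_def z1_def by (rule pairing_kernel_op_chirp[OF \<alpha> z])
  also have "pairing (kernel_op (chirp c' b \<beta>) \<psi>) z' w'
    = c' * csqrt (of_real pi / z2) * exp (w'\<^sup>2 / (4 * z2)) *
        pairing \<psi> ((of_real \<beta>)\<^sup>2 / (4 * z2) - \<i> * of_real b) (\<i> * of_real \<beta> * w' / (2 * z2))"
    unfolding z2_def by (rule pairing_kernel_op_chirp[OF \<beta> z'])
  also have "(of_real \<beta>)\<^sup>2 / (4 * z2) = (of_real \<beta>)\<^sup>2 * z1 / (4 * D)" unfolding D by simp
  also have "\<i> * of_real \<beta> * w' / (2 * z2) = - (of_real \<alpha> * of_real \<beta> * w / (4 * D))"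
    unfolding D w'_def using z1(2) D0 by (simp add: field_simps)
  also have "w'\<^sup>2 / (4 * z2) = - (of_real \<alpha>)\<^sup>2 * w\<^sup>2 / (16 * z1 * D)"
    unfolding D w'_def using z1(2) D0 by (simp add: field_simps power2_eq_square)
  finally have *: "pairing (kernel_op (chirp c a \<alpha>) (kernel_op (chirp c' b \<beta>) \<psi>)) z w
    = c * c' * (csqrt (of_real pi / z1) * csqrt (of_real pi / z2)) *
      (exp (w\<^sup>2 / (4 * z1)) * exp (- (of_real \<alpha>)\<^sup>2 * w\<^sup>2 / (16 * z1 * D))) *
      pairing \<psi> ((of_real \<beta>)\<^sup>2 * z1 / (4 * D) - \<i> * of_real b) (- (of_real \<alpha> * of_real \<beta> * w / (4 * D)))"
    by (simp only: mult_ac)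
  \<comment> \<open>The two exponents combine into one in which \<open>z1\<close> cancels, leaving a
    denominator that involves only \<open>D\<close>.\<close>
  have "w\<^sup>2 / (4 * z1) + - (of_real \<alpha>)\<^sup>2 * w\<^sup>2 / (16 * z1 * D) = (4 * D - (of_real \<alpha>)\<^sup>2) * w\<^sup>2 / (16 * z1 * D)"
    using z1(2) D0 by (simp add: field_simps)
  also have "4 * D - (of_real \<alpha>)\<^sup>2 = - 4 * \<i> * (of_real a + of_real b) * z1"
    by (simp add: D_def)
  also have "- 4 * \<i> * (of_real a + of_real b) * z1 * w\<^sup>2 / (16 * z1 * D) = - \<i> * (of_real a + of_real b) * w\<^sup>2 / (4 * D)"
    using z1(2) D0 by (simp add: field_simps)
  finally show "pairing (kernel_op (chirp c a \<alpha>) (kernel_op (chirp c' b \<beta>) \<psi>)) z w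
    = c * c' * (csqrt (of_real pi / z1) * csqrt (of_real pi * z1 / D)) * exp (- \<i> * (of_real a + of_real b) * w\<^sup>2 / (4 * D)) *
      pairing \<psi> ((of_real \<beta>)\<^sup>2 * z1 / (4 * D) - \<i> * of_real b) (- (of_real \<alpha> * of_real \<beta> * w / (4 * D)))"
    unfolding * exp_add[symmetric] e by simp
qed

text \<open>The composition formula is compared factor by factor in both orders. The invariant makes
  the two \<open>D\<close> equal, the square roots agree by the half plane argument, and the new
  quadratic parameters agree by a polynomial identity.\<close>

lemma kernel_op_chirp_commute:
  fixes a b \<alpha> \<beta> :: real
  assumes \<alpha>: "\<alpha> \<noteq> 0" and \<beta>: "\<beta> \<noteq> 0" and inv: "\<alpha>\<^sup>2 - 4 * a\<^sup>2 = \<beta>\<^sup>2 - 4 * b\<^sup>2"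
  shows "kernel_op (chirp c a \<alpha>) \<circ> kernel_op (chirp c' b \<beta>) = kernel_op (chirp c' b \<beta>) \<circ> kernel_op (chirp c a \<alpha>)"
proof (rule ext, unfold comp_apply, rule L2_eqI)
  fix \<psi> and z w :: complex assume z: "Re z > 0"
  define za zb where "za = z - \<i> * of_real a" and "zb = z - \<i> * of_real b"
  define D where "D = (of_real \<alpha>)\<^sup>2 / 4 - \<i> * (of_real a + of_real b) * za"
  note comp1 = pairing_kernel_op_chirp_comp[OF \<alpha> \<beta> z] and comp2 = pairing_kernel_op_chirp_comp[OF \<beta> \<alpha> z]
  have \<beta>2: "complex_of_real \<beta> ^ 2 = complex_of_real \<alpha> ^ 2 - 4 * complex_of_real a ^ 2 + 4 * complex_of_real b ^ 2"
  proof -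
    have "\<beta>\<^sup>2 = \<alpha>\<^sup>2 - 4 * a\<^sup>2 + 4 * b\<^sup>2" using inv by simp
    from arg_cong[OF this, of complex_of_real] show ?thesis by simp
  qed
  have D': "(of_real \<beta>)\<^sup>2 / 4 - \<i> * (of_real b + of_real a) * zb = D"
    unfolding \<beta>2 D_def za_def zb_def by (simp add: field_simps power2_eq_square)
  have D0: "D \<noteq> 0" unfolding D_def za_def by (rule comp1(4))
  have sqrt_eq: "csqrt (of_real pi / za) * csqrt (of_real pi * za / D) = csqrt (of_real pi / zb) * csqrt (of_real pi * zb / D)"
  proof (rule csqrt_mult_right_half_plane)
    have "za \<noteq> 0" "zb \<noteq> 0" using z by (auto simp: za_def zb_def)
    then show "of_real pi / za * (of_real pi * za / D) = of_real pi / zb * (of_real pi * zb / D)" by simp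
    show "Re (of_real pi / za) > 0" "Re (of_real pi * za / D) > 0"
      unfolding D_def za_def by (fact comp1(2) comp1(3))+
    show "Re (of_real pi / zb) > 0" "Re (of_real pi * zb / D) > 0"
      unfolding D'[symmetric] zb_def by (fact comp2(2) comp2(3))+
  qed
  have z_eq: "(of_real \<beta>)\<^sup>2 * za / (4 * D) - \<i> * of_real b = (of_real \<alpha>)\<^sup>2 * zb / (4 * D) - \<i> * of_real a"
  proof -
    have "(of_real \<beta>)\<^sup>2 * za - 4 * D * (\<i> * of_real b) = (of_real \<alpha>)\<^sup>2 * zb - 4 * D * (\<i> * of_real a)"
      unfolding \<beta>2 D_def za_def zb_def by (simp add: field_simps power2_eq_square)
    then have "((of_real \<beta>)\<^sup>2 * za - 4 * D * (\<i> * of_real b)) / (4 * D) = ((of_real \<alpha>)\<^sup>2 * zb - 4 * D * (\<i> * of_real a)) / (4 * D)"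
      by (rule arg_cong)
    then show ?thesis using D0 by (simp add: diff_divide_distrib)
  qed
  have "pairing (kernel_op (chirp c a \<alpha>) (kernel_op (chirp c' b \<beta>) \<psi>)) z w
    = c * c' * (csqrt (of_real pi / za) * csqrt (of_real pi * za / D)) * exp (- \<i> * (of_real a + of_real b) * w\<^sup>2 / (4 * D)) *
      pairing \<psi> ((of_real \<beta>)\<^sup>2 * za / (4 * D) - \<i> * of_real b) (- (of_real \<alpha> * of_real \<beta> * w / (4 * D)))"
    unfolding D_def za_def by (rule comp1(1))
  moreover have "pairing (kernel_op (chirp c' b \<beta>) (kernel_op (chirp c a \<alpha>) \<psi>)) z w
    = c' * c * (csqrt (of_real pi / zb) * csqrt (of_real pi * zb / D)) * exp (- \<i> * (of_real b + of_real a) * w\<^sup>2 / (4 * D)) *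
      pairing \<psi> ((of_real \<alpha>)\<^sup>2 * zb / (4 * D) - \<i> * of_real a) (- (of_real \<beta> * of_real \<alpha> * w / (4 * D)))"
    unfolding D'[symmetric] zb_def by (rule comp2(1))
  ultimately show "pairing (kernel_op (chirp c a \<alpha>) (kernel_op (chirp c' b \<beta>) \<psi>)) z w
    = pairing (kernel_op (chirp c' b \<beta>) (kernel_op (chirp c a \<alpha>) \<psi>)) z w"
    unfolding sqrt_eq z_eq
    by (simp only: add.commute[of "of_real b"] mult.commute[of c'] mult.commute[of "of_real \<beta>"])
qed

text \<open>For opposite coefficients \<open>D\<close> becomes \<open>\<alpha>\<^sup>2 / 4\<close>,
  independent of \<open>z\<close>; the exponential factor is 1 and the parameters return to
  \<open>z\<close> and \<open>w\<close>. The square roots contribute 2 pi / |\<alpha>|, which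
  \<open>c * c'\<close> compensates.\<close>

lemma kernel_op_chirp_inverse:
  assumes \<alpha>: "\<alpha> \<noteq> 0" and c: "c * c' = of_real (\<bar>\<alpha>\<bar> / (2 * pi))"
  shows "kernel_op (chirp c a \<alpha>) \<circ> kernel_op (chirp c' (- a) (- \<alpha>)) = id"
proof (rule ext, unfold comp_apply id_apply, rule L2_eqI)
  fix \<psi> and z w :: complex assume z: "Re z > 0"
  define z1 where "z1 = z - \<i> * of_real a"
  define D where "D = (of_real \<alpha>)\<^sup>2 / (4 :: complex)"
  have "- \<alpha> \<noteq> 0" using \<alpha> by simp
  note comp = pairing_kernel_op_chirp_comp[OF \<alpha> this z]
  have D': "(of_real \<alpha>)\<^sup>2 / 4 - \<i> * (of_real a + of_real (- a)) * z1 = D" by (simp add: D_def)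
  have z1: "z1 \<noteq> 0" using z by (auto simp: z1_def)
  have D0: "D \<noteq> 0" using \<alpha> by (simp add: D_def)
  \<comment> \<open>The positive number whose square is the product of the two radicands; writing it
    as \<open>csqrt s * csqrt s\<close> makes the half plane lemma applicable.\<close>
  define s where "s = complex_of_real (2 * pi / \<bar>\<alpha>\<bar>)"
  have "csqrt (of_real pi / z1) * csqrt (of_real pi * z1 / D) = csqrt s * csqrt s"
  proof (rule csqrt_mult_right_half_plane)
    have "(complex_of_real \<bar>\<alpha>\<bar>)\<^sup>2 = (complex_of_real \<alpha>)\<^sup>2" unfolding of_real_power[symmetric] by simp
    then show "of_real pi / z1 * (of_real pi * z1 / D) = s * s"
      using z1 \<alpha> by (simp add: s_def D_def power2_eq_square)
    show "Re (of_real pi / z1) > 0" "Re (of_real pi * z1 / D) > 0"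
      unfolding D'[symmetric] z1_def by (fact comp(2) comp(3))+
    show "Re s > 0" "Re s > 0" using \<alpha> by (simp_all add: s_def)
  qed
  also have "csqrt s * csqrt s = s"
    unfolding power2_eq_square[symmetric] by (rule power2_csqrt)
  finally have cs: "c * c' * (csqrt (of_real pi / z1) * csqrt (of_real pi * z1 / D)) = 1"
    unfolding c s_def using \<alpha> by simp
  have "pairing (kernel_op (chirp c a \<alpha>) (kernel_op (chirp c' (- a) (- \<alpha>)) \<psi>)) z w
    = c * c' * (csqrt (of_real pi / z1) * csqrt (of_real pi * z1 / D)) * exp (- \<i> * (of_real a + of_real (- a)) * w\<^sup>2 / (4 * D)) *
      pairing \<psi> ((of_real (- \<alpha>))\<^sup>2 * z1 / (4 * D) - \<i> * of_real (- a)) (- (of_real \<alpha> * of_real (- \<alpha>) * w / (4 * D)))"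
    unfolding D'[symmetric] z1_def by (rule comp(1))
  also have "(of_real (- \<alpha>))\<^sup>2 * z1 / (4 * D) - \<i> * of_real (- a) = z"
    using \<alpha> by (simp add: D_def z1_def)
  also have "- (of_real \<alpha> * of_real (- \<alpha>) * w / (4 * D)) = w"
    using \<alpha> by (simp add: D_def power2_eq_square)
  finally show "pairing (kernel_op (chirp c a \<alpha>) (kernel_op (chirp c' (- a) (- \<alpha>)) \<psi>)) z w = pairing \<psi> z w"
    unfolding cs by simp
qed

section \<open>One-step kernels and lattice paths\<close>

lemma forward_kernel_eq_chirp:
  "forward_kernel hbar P s = chirp (csqrt (\<i> * of_real (P + s\<^sup>2) / of_real (2 * pi * hbar * s)))
    ((P - s\<^sup>2) / (2 * s * hbar)) ((P + s\<^sup>2) / (s * hbar))"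
proof (intro ext)
  fix x y
  have "lagrangian P s x y / hbar
    = (P - s\<^sup>2) / (2 * s * hbar) * x\<^sup>2 + (P + s\<^sup>2) / (s * hbar) * x * y + (P - s\<^sup>2) / (2 * s * hbar) * y\<^sup>2"
    unfolding lagrangian_def
    \<comment> \<open>If \<open>s\<close> or \<open>hbar\<close> is 0, both sides are 0 because
      division by zero yields 0.\<close>
    by (cases "s = 0 \<or> hbar = 0") (auto simp: field_simps)
  then have "\<i> / of_real hbar * of_real (lagrangian P s x y) = \<i> * of_real
      ((P - s\<^sup>2) / (2 * s * hbar) * x\<^sup>2 + (P + s\<^sup>2) / (s * hbar) * x * y + (P - s\<^sup>2) / (2 * s * hbar) * y\<^sup>2)"
    by (metis of_real_divide times_divide_eq_left times_divide_eq_right)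
  then show "forward_kernel hbar P s x y = chirp (csqrt (\<i> * of_real (P + s\<^sup>2) / of_real (2 * pi * hbar * s)))
    ((P - s\<^sup>2) / (2 * s * hbar)) ((P + s\<^sup>2) / (s * hbar)) x y"
    unfolding forward_kernel_def chirp_def by (simp only:)
qed

lemma cnj_chirp: "cnj (chirp c a \<alpha> x y) = chirp (cnj c) (- a) (- \<alpha>) x y"
  by (simp add: chirp_def exp_cnj algebra_simps)

lemma backward_kernel_eq_chirp:
  "backward_kernel hbar P s = chirp (cnj (csqrt (\<i> * of_real (P + s\<^sup>2) / of_real (2 * pi * hbar * s))))
    (- ((P - s\<^sup>2) / (2 * s * hbar))) (- ((P + s\<^sup>2) / (s * hbar)))"
  by (intro ext) (simp add: backward_kernel_def forward_kernel_eq_chirp cnj_chirp chirp_commute[of _ _ _ y for y])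

text \<open>The normalisation is exactly right: \<open>(cmod c)\<^sup>2\<close> for the prefactor
  \<open>c\<close> equals |\<alpha>| / (2 pi), whichever branch of the root is taken.\<close>

lemma kernel_op_forward_backward:
  assumes "hbar > 0" "s \<noteq> 0" "P + s\<^sup>2 \<noteq> 0"
  shows "kernel_op (forward_kernel hbar P s) \<circ> kernel_op (backward_kernel hbar P s) = id"
    and "kernel_op (backward_kernel hbar P s) \<circ> kernel_op (forward_kernel hbar P s) = id"
proof -
  let ?c = "csqrt (\<i> * of_real (P + s\<^sup>2) / of_real (2 * pi * hbar * s))"
  let ?a = "(P - s\<^sup>2) / (2 * s * hbar)" and ?\<alpha> = "(P + s\<^sup>2) / (s * hbar)"
  have \<alpha>: "?\<alpha> \<noteq> 0" "- ?\<alpha> \<noteq> 0" using assms by simp_all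
  have "(cmod ?c)\<^sup>2 = cmod (\<i> * of_real (P + s\<^sup>2) / of_real (2 * pi * hbar * s))"
    by (metis norm_power power2_csqrt)
  also have "\<dots> = \<bar>P + s\<^sup>2\<bar> / \<bar>2 * pi * hbar * s\<bar>"
    by (simp only: norm_mult norm_divide norm_ii norm_of_real mult_1)
  also have "\<dots> = \<bar>?\<alpha>\<bar> / (2 * pi)"
    using assms(1) by (simp add: abs_mult field_simps)
  finally have c: "?c * cnj ?c = of_real (\<bar>?\<alpha>\<bar> / (2 * pi))"
    by (metis complex_norm_square)
  then have c': "cnj ?c * ?c = of_real (\<bar>- ?\<alpha>\<bar> / (2 * pi))"
    by (simp only: mult.commute[of "cnj _"] abs_minus_cancel)
  show "kernel_op (forward_kernel hbar P s) \<circ> kernel_op (backward_kernel hbar P s) = id"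
    unfolding forward_kernel_eq_chirp backward_kernel_eq_chirp
    by (rule kernel_op_chirp_inverse[OF \<alpha>(1) c])
  show "kernel_op (backward_kernel hbar P s) \<circ> kernel_op (forward_kernel hbar P s) = id"
    unfolding forward_kernel_eq_chirp backward_kernel_eq_chirp
    using kernel_op_chirp_inverse[OF \<alpha>(2) c', of "- ?a"] by (simp only: minus_minus)
qed

text \<open>The invariant \<open>\<alpha>\<^sup>2 - 4 a\<^sup>2\<close> of a chirp kernel equals \<open>4 P / hbar\<^sup>2\<close> in both lattice directions.\<close>

lemma kernel_op_forward_commute:
  assumes "hbar > 0" "q \<noteq> 0" "r \<noteq> 0" "P + q\<^sup>2 \<noteq> 0" "P + r\<^sup>2 \<noteq> 0"
  shows "kernel_op (forward_kernel hbar P q) \<circ> kernel_op (forward_kernel hbar P r)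
    = kernel_op (forward_kernel hbar P r) \<circ> kernel_op (forward_kernel hbar P q)"
  unfolding forward_kernel_eq_chirp
proof (rule kernel_op_chirp_commute)
  have inv: "((P + s\<^sup>2) / (s * hbar))\<^sup>2 - 4 * ((P - s\<^sup>2) / (2 * s * hbar))\<^sup>2 = 4 * P / hbar\<^sup>2" if "s \<noteq> 0" for s
  proof -
    have half: "4 * (x / (2 * s * hbar))\<^sup>2 = x\<^sup>2 / (s * hbar)\<^sup>2" for x
      by (simp add: power_divide power_mult_distrib)
    have "((P + s\<^sup>2) / (s * hbar))\<^sup>2 - 4 * ((P - s\<^sup>2) / (2 * s * hbar))\<^sup>2
      = ((P + s\<^sup>2)\<^sup>2 - (P - s\<^sup>2)\<^sup>2) / (s * hbar)\<^sup>2"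
      unfolding half by (simp only: power_divide diff_divide_distrib)
    also have "(P + s\<^sup>2)\<^sup>2 - (P - s\<^sup>2)\<^sup>2 = 4 * P * s\<^sup>2" by (simp add: power2_eq_square algebra_simps)
    finally show ?thesis using that by (simp add: power_mult_distrib)
  qed
  show "((P + q\<^sup>2) / (q * hbar))\<^sup>2 - 4 * ((P - q\<^sup>2) / (2 * q * hbar))\<^sup>2
    = ((P + r\<^sup>2) / (r * hbar))\<^sup>2 - 4 * ((P - r\<^sup>2) / (2 * r * hbar))\<^sup>2"
    using assms inv by simp
qed (use assms in simp_all)

section \<open>Integer powers of bijections and lattice paths\<close>

text \<open>The integer powers of a bijection \<open>f\<close>, with \<open>g\<close> in the role of
  its inverse.\<close>

definition int_funpow :: "('a \<Rightarrow> 'a) \<Rightarrow> ('a \<Rightarrow> 'a) \<Rightarrow> int \<Rightarrow> 'a \<Rightarrow> 'a" where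
  "int_funpow f g k = (if k \<ge> 0 then f ^^ nat k else g ^^ nat (- k))"

lemma int_funpow_0 [simp]: "int_funpow f g 0 = id"
  by (simp add: int_funpow_def)

lemma int_funpow_swap: "int_funpow f g k = int_funpow g f (- k)"
  by (simp add: int_funpow_def)

lemma int_funpow_add_1:
  assumes "g \<circ> f = id"
  shows "int_funpow f g k \<circ> f = int_funpow f g (k + 1)"
proof (cases "k \<ge> 0")
  case True
  then show ?thesis by (simp add: int_funpow_def nat_add_distrib funpow_Suc_right del: funpow.simps)
next
  case False
  \<comment> \<open>For negative \<open>k\<close> the innermost \<open>g\<close> is split off and
    cancels \<open>f\<close>; at \<open>k = -1\<close> the other branch of the definition takes over
    with exponent 0.\<close>
  then have "nat (- k) = Suc (nat (- (k + 1)))" by simp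
  then have "int_funpow f g k \<circ> f = (g ^^ nat (- (k + 1))) \<circ> (g \<circ> f)"
    using False by (simp only: int_funpow_def if_False funpow_Suc_right comp_assoc)
  then show ?thesis using False assms by (simp add: int_funpow_def)
qed

lemma int_funpow_diff_1:
  assumes "f \<circ> g = id"
  shows "int_funpow f g k \<circ> g = int_funpow f g (k - 1)"
  using int_funpow_add_1[OF assms, of "- k"] by (simp add: int_funpow_swap[of f g])

lemma int_funpow_comm:
  assumes "f \<circ> h = h \<circ> f" "g \<circ> h = h \<circ> g"
  shows "int_funpow f g k \<circ> h = h \<circ> int_funpow f g k"
proof -
  have "(f' ^^ n) \<circ> h = h \<circ> (f' ^^ n)" if "f' \<circ> h = h \<circ> f'" for f' and n :: nat
  proof (induction n)
    case (Suc n)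
    have "(f' ^^ Suc n) \<circ> h = f' \<circ> ((f' ^^ n) \<circ> h)" by (simp add: comp_assoc)
    also have "\<dots> = (f' \<circ> h) \<circ> (f' ^^ n)" by (simp only: Suc comp_assoc)
    also have "\<dots> = h \<circ> (f' ^^ Suc n)" by (simp add: that comp_assoc)
    finally show ?case .
  qed simp
  then show ?thesis using assms by (simp add: int_funpow_def)
qed

text \<open>The operator of the first step acts first and hence stands on the right, which is where
  \<open>step\<close> extends \<open>T\<close>; along the path the displacements telescope.\<close>

lemma propagator_eq:
  assumes step: "\<And>v d. d \<in> {(1, 0), (-1, 0), (0, 1), (0, -1)} \<Longrightarrow>
      T v \<circ> kernel_op (step_kernel hbar P q r d) = T (v + d)"
    and T0: "T 0 = id"
    and path: "\<forall>s < length ns. (m # ns) ! (s + 1) - (m # ns) ! s \<in> {(1, 0), (-1, 0), (0, 1), (0, -1)}"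
  shows "propagator hbar P q r (m # ns) = T (last (m # ns) - m)"
  using path
proof (induction ns arbitrary: m)
  case Nil
  then show ?case by (simp add: T0)
next
  case (Cons n ns)
  have "n - m \<in> {(1, 0), (-1, 0), (0, 1), (0, -1)}"
    using spec[OF Cons.prems, of 0] by simp
  moreover have "\<forall>s < length ns. (n # ns) ! (s + 1) - (n # ns) ! s \<in> {(1, 0), (-1, 0), (0, 1), (0, -1)}"
    using Cons.prems by fastforce
  ultimately have "propagator hbar P q r (m # n # ns) = T (last (n # ns) - n + (n - m))"
    using step Cons.IH by (simp only: propagator.simps)
  then show ?case by simp
qed

theorem proposition1:
  fixes hbar P q r Q R :: real
    and \<Gamma>\<^sub>1 \<Gamma>\<^sub>2 :: "(int \<times> int) list"
  assumes "hbar > 0"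
    and "q \<noteq> 0" and "r \<noteq> 0"
    and "Q = q\<^sup>2" and "R = r\<^sup>2"
    and "P + Q \<noteq> 0" and "P + R \<noteq> 0"
    and "lattice_path \<Gamma>\<^sub>1" and "lattice_path \<Gamma>\<^sub>2"
    and "hd \<Gamma>\<^sub>1 = hd \<Gamma>\<^sub>2" and "last \<Gamma>\<^sub>1 = last \<Gamma>\<^sub>2"
  shows "propagator hbar P q r \<Gamma>\<^sub>1 = propagator hbar P q r \<Gamma>\<^sub>2"
proof -
  define A where "A = kernel_op (forward_kernel hbar P q)"
  define A' where "A' = kernel_op (backward_kernel hbar P q)"
  define B where "B = kernel_op (forward_kernel hbar P r)"
  define B' where "B' = kernel_op (backward_kernel hbar P r)"
  have A: "A \<circ> A' = id" "A' \<circ> A = id" and B: "B \<circ> B' = id" "B' \<circ> B = id"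
    unfolding A_def A'_def B_def B'_def using assms by (simp_all add: kernel_op_forward_backward)
  have AB: "A \<circ> B = B \<circ> A"
    unfolding A_def B_def using assms by (intro kernel_op_forward_commute) simp_all
  have commute_inverse: "g \<circ> h = h \<circ> g" if "f \<circ> g = id" "g \<circ> f = id" "f \<circ> h = h \<circ> f" for f g h :: "L2 \<Rightarrow> L2"
  proof -
    have "g \<circ> h = g \<circ> (h \<circ> f) \<circ> g" using that(1) by (simp add: comp_assoc)
    also have "\<dots> = (g \<circ> f) \<circ> h \<circ> g" by (simp only: that(3)[symmetric] comp_assoc)
    finally show ?thesis using that(2) by simp
  qed
  have B'A: "B' \<circ> A = A \<circ> B'" by (rule commute_inverse[OF B AB[symmetric]])
  have A'B: "A' \<circ> B = B \<circ> A'" by (rule commute_inverse[OF A AB])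
  have B'A': "B' \<circ> A' = A' \<circ> B'" by (rule commute_inverse[OF B A'B[symmetric]])
  \<comment> \<open>The operator of the displacement \<open>v\<close>. With the powers of
    \<open>A\<close> on the left, a step in the second direction is absorbed directly, while
    \<open>A\<close> or \<open>A'\<close> must first pass the powers of \<open>B\<close>.\<close>
  define T where "T v = int_funpow A A' (fst v) \<circ> int_funpow B B' (snd v)" for v :: "int \<times> int"
  have step: "T v \<circ> kernel_op (step_kernel hbar P q r d) = T (v + d)"
    if "d \<in> {(1, 0), (-1, 0), (0, 1), (0, -1)}" for v d
  proof -
    have "T v \<circ> A = T (v + (1, 0))" "T v \<circ> A' = T (v + (-1, 0))"
      unfolding T_def
      using int_funpow_comm[OF AB[symmetric] B'A, of "snd v"] int_funpow_comm[OF A'B[symmetric] B'A', of "snd v"]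
        int_funpow_add_1[OF A(2), of "fst v"] int_funpow_diff_1[OF A(1), of "fst v"]
      by (simp_all add: comp_assoc) (simp_all flip: comp_assoc)
    moreover have "T v \<circ> B = T (v + (0, 1))" "T v \<circ> B' = T (v + (0, -1))"
      unfolding T_def using int_funpow_add_1[OF B(2), of "snd v"] int_funpow_diff_1[OF B(1), of "snd v"]
      by (simp_all add: comp_assoc)
    ultimately show ?thesis
      using that by (auto simp: step_kernel_def A_def A'_def B_def B'_def)
  qed
  have "propagator hbar P q r \<Gamma> = T (last \<Gamma> - hd \<Gamma>)" if "lattice_path \<Gamma>" for \<Gamma>
  proof (cases \<Gamma>)
    case Nil
    with that show ?thesis by (simp add: lattice_path_def)
  next
    case (Cons m ns)
    with that have "propagator hbar P q r (m # ns) = T (last (m # ns) - m)"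
      by (intro propagator_eq step) (auto simp: T_def lattice_path_def)
    with Cons show ?thesis by simp
  qed
  with assms show ?thesis by simp
qed

end
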